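(* Let $\Omega=\{(x,y): x\in[a,b],\ \varphi_1(x)\le y\le\varphi_2(x)\}$ be a convex compact domain in $\mathbb{R}^2$, where $\varphi_1$ is convex and $\varphi_2$ is concave on $[a,b]$, and let $$m=\max\{|\varphi_i'(x)|:\ i\in\{1,2\},\ x\in[a,b]\}\in[0,+\infty].$$ If both vertical lines of support of $\Omega$ (parallel to the $y$-axis) are angular, then $$K_\infty(\Omega)=\sup_{u\in\mathcal{U}_\Omega,\ u\neq0}\frac{\|u_x\|_\infty}{\|u_y\|_\infty}=m<\infty ;$$ otherwise $K_\infty(\Omega)=\infty$.
   Context: A convex compact domain is a compact convex set $\Omega\subset\mathbb{R}^2$ with nonempty interior. $\mathcal{U}_\Omega$ denotes the class of continuous concave functions $u:\Omega\to\mathbb{R}$ with $u|_{\partial\Omega}=0$ whose gradient $\nabla u=(u_x,u_y)$ is uniformly bounded over all interior points of $\Omega$ at which it is defined (it is defined almost everywhere). $\|f\|_\infty=\operatorname{ess\,sup}_{\Omega}|f|$. In the definition of $m$, derivatives are one-sided derivatives (possibly infinite at $a$ and $b$); the maximum is attained at $x=a$ or $x=b$. The tangent cone to $\Omega$ with vertex at $\xi\in\partial\Omega$ is the intersection of all closed half-planes containing $\Omega$ and bounded by lines of support of $\Omega$ through $\xi$. A point $\xi\in\partial\Omega$ is singular if there is more than one line of support to $\Omega$ through $\xi$. A line is called an angular support line if, for some singular point $\xi\in\partial\Omega$, it intersects the tangent cone with vertex $\xi$ exactly in $\xi$. *)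

theory Defs
  imports "HOL-Probability.Probability"
begin

type_synonym plane = "real \<times> real"

definition convex_compact_domain :: "plane set \<Rightarrow> bool" where
  "convex_compact_domain \<Omega> \<longleftrightarrow> compact \<Omega> \<and> convex \<Omega> \<and> interior \<Omega> \<noteq> {}"

definition line :: "plane \<Rightarrow> real \<Rightarrow> plane set" where
  "line n c = {p. n \<bullet> p = c}"

definition half_plane :: "plane \<Rightarrow> real \<Rightarrow> plane set" where
  "half_plane n c = {p. n \<bullet> p \<le> c}"

definition is_line :: "plane set \<Rightarrow> bool" where
  "is_line L \<longleftrightarrow> (\<exists>n c. n \<noteq> 0 \<and> L = line n c)"

definition vertical_line :: "plane set \<Rightarrow> bool" where
  "vertical_line L \<longleftrightarrow> (\<exists>c. L = {p. fst p = c})"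

definition support_line :: "plane set \<Rightarrow> plane set \<Rightarrow> bool" where
  "support_line \<Omega> L \<longleftrightarrow>
     (\<exists>n c. n \<noteq> 0 \<and> L = line n c \<and> \<Omega> \<subseteq> half_plane n c \<and> L \<inter> \<Omega> \<noteq> {})"

definition tangent_cone :: "plane set \<Rightarrow> plane \<Rightarrow> plane set" where
  "tangent_cone \<Omega> \<xi> =
     \<Inter> {half_plane n c | n c. n \<noteq> 0 \<and> \<Omega> \<subseteq> half_plane n c \<and>
                          support_line \<Omega> (line n c) \<and> \<xi> \<in> line n c}"

definition singular_point :: "plane set \<Rightarrow> plane \<Rightarrow> bool" where
  "singular_point \<Omega> \<xi> \<longleftrightarrow> \<xi> \<in> frontier \<Omega> \<and>
     (\<exists>L L'. L \<noteq> L' \<and> support_line \<Omega> L \<and> support_line \<Omega> L' \<and> \<xi> \<in> L \<and> \<xi> \<in> L')"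

definition angular_support_line :: "plane set \<Rightarrow> plane set \<Rightarrow> bool" where
  "angular_support_line \<Omega> L \<longleftrightarrow> is_line L \<and>
     (\<exists>\<xi>. singular_point \<Omega> \<xi> \<and> L \<inter> tangent_cone \<Omega> \<xi> = {\<xi>})"

text \<open>One-sided derivatives are taken in the extended reals, since they may be infinite at the
  endpoints. For a convex or concave function on \<open>{a..b}\<close> they exist at every point, and the
  supremum of their absolute values is a maximum, attained at \<open>a\<close> or \<open>b\<close>.\<close>

definition one_sided_derivs :: "real \<Rightarrow> real \<Rightarrow> (real \<Rightarrow> real) \<Rightarrow> ereal set" where
  "one_sided_derivs a b f =
     {d. \<exists>x\<in>{a..<b}. ((\<lambda>t. ereal ((f t - f x) / (t - x))) \<longlongrightarrow> d) (at_right x)} \<union>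
     {d. \<exists>x\<in>{a<..b}. ((\<lambda>t. ereal ((f t - f x) / (t - x))) \<longlongrightarrow> d) (at_left x)}"

definition max_slope :: "real \<Rightarrow> real \<Rightarrow> (real \<Rightarrow> real) \<Rightarrow> (real \<Rightarrow> real) \<Rightarrow> ereal" where
  "max_slope a b \<phi>\<^sub>1 \<phi>\<^sub>2 = (SUP d \<in> one_sided_derivs a b \<phi>\<^sub>1 \<union> one_sided_derivs a b \<phi>\<^sub>2. \<bar>d\<bar>)"

text \<open>For \<open>u\<close> in the class below, the partial derivatives exist almost everywhere on \<open>\<Omega>\<close> (whose
  boundary is a null set), so the unspecified value of \<^const>\<open>deriv\<close> elsewhere, and the values of
  \<open>u\<close> outside \<open>\<Omega>\<close>, do not influence the essential suprema.\<close>

definition partial_x :: "(plane \<Rightarrow> real) \<Rightarrow> plane \<Rightarrow> real" where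
  "partial_x u p = deriv (\<lambda>t. u (t, snd p)) (fst p)"

definition partial_y :: "(plane \<Rightarrow> real) \<Rightarrow> plane \<Rightarrow> real" where
  "partial_y u p = deriv (\<lambda>t. u (fst p, t)) (snd p)"

definition has_gradient :: "(plane \<Rightarrow> real) \<Rightarrow> plane \<Rightarrow> bool" where
  "has_gradient u p \<longleftrightarrow>
     (\<lambda>t. u (t, snd p)) differentiable (at (fst p)) \<and>
     (\<lambda>t. u (fst p, t)) differentiable (at (snd p))"

definition concave_class :: "plane set \<Rightarrow> (plane \<Rightarrow> real) set" where
  "concave_class \<Omega> = {u. continuous_on \<Omega> u \<and> concave_on \<Omega> u \<and> (\<forall>p\<in>frontier \<Omega>. u p = 0) \<and>
     (\<exists>C. \<forall>p\<in>interior \<Omega>. has_gradient u p \<longrightarrow> norm (partial_x u p, partial_y u p) \<le> C)}"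

text \<open>The completed measure is used because \<^const>\<open>esssup\<close> presupposes measurability, and the
  partial derivatives are only determined up to a null set.\<close>

definition sup_norm :: "plane set \<Rightarrow> (plane \<Rightarrow> real) \<Rightarrow> ereal" where
  "sup_norm \<Omega> f = esssup (lebesgue_on \<Omega>) (\<lambda>p. ereal \<bar>f p\<bar>)"

definition K_inf :: "plane set \<Rightarrow> ereal" where
  "K_inf \<Omega> = (SUP u \<in> {u \<in> concave_class \<Omega>. \<exists>p\<in>\<Omega>. u p \<noteq> 0}.
                 sup_norm \<Omega> (partial_x u) / sup_norm \<Omega> (partial_y u))"

end

theory Submission
  imports Defs
begin

text \<open>
  Both inequalities compare the two partial derivatives by a one-dimensional argument along lines
  parallel to the axes. For \<open>u\<close> concave, an essential bound \<open>M\<close> on a partial derivative is a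
  genuine Lipschitz bound along the lines parallel to that axis, up to the boundary
  (\<open>Lipschitz_along_axis\<close>): the points where the derivative exists and obeys the bound are dense,
  and concavity bounds increments by derivatives.

  \<^emph>\<open>Upper bound.\<close> Suppose that \<open>\<Omega>\<close> ends at \<open>x = a\<close> in a single point \<open>\<xi>\<close> and lies in the cone with
  vertex \<open>\<xi>\<close> and slopes \<open>\<plusminus>m\<close>. Let \<open>p = (x, y)\<close> be an interior point and \<open>M\<close> the bound on \<open>u\<^sub>y\<close>. As \<open>u\<close>
  is concave with \<open>u \<xi> = 0\<close>, it decreases along the segment from \<open>p\<close> to \<open>\<xi>\<close> at rate at most \<open>u p\<close>;
  replacing the points of the segment by their vertical projections to the horizontal line through
  \<open>p\<close> costs at most \<open>M\<close> times the vertical displacement. Hence \<open>u\<^sub>x p \<cdot> (x - a)\<close> is at most \<open>u p\<close> plus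
  \<open>M\<close> times the vertical distance from \<open>p\<close> to \<open>\<xi>\<close>. Since \<open>u\<close> vanishes at the two ends of the vertical
  chord through \<open>p\<close>, this is at most \<open>M\<close> times the vertical distance from \<open>\<xi>\<close> to one of these ends,
  which the cone bounds by \<open>m (x - a)\<close>. So \<open>u\<^sub>x \<le> m M\<close>, and the corner at \<open>x = b\<close> gives
  \<open>- u\<^sub>x \<le> m M\<close> (\<open>dir_deriv_x_le\<close>, \<open>K_inf_le\<close>).

  \<^emph>\<open>Lower bound.\<close> For \<open>R > 0\<close> let \<open>u p\<close> be the distance from \<open>p\<close> to the complement of \<open>\<Omega>\<close> in the norm
  \<open>R \<bar>x\<bar> + \<bar>y\<bar>\<close>. It is concave, vanishes on the frontier and has \<open>\<bar>u\<^sub>y\<bar> \<le> 1\<close>. The balls of this norm are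
  diamonds; if one of them lies in \<open>\<Omega>\<close> and has its left or right vertex on the frontier, then along
  the horizontal radius at that vertex \<open>u\<close> grows at the rate \<open>R\<close>, hence \<open>R \<le> K_inf \<Omega>\<close>
  (\<open>K_inf_ge_if_diamond\<close>). Such a diamond exists whenever one of the graphs rises
  (for \<open>\<phi>\<^sub>2\<close>) or falls (for \<open>\<phi>\<^sub>1\<close>) from an end point of \<open>[a, b]\<close> with a chord steeper than \<open>R\<close>, or \<open>\<Omega>\<close>
  has a vertical edge. By concavity some chord is that steep as soon as some one-sided derivative
  exceeds \<open>R\<close> in absolute value. This gives \<open>max_slope\<close> as a lower bound.

  \<^emph>\<open>The dichotomy.\<close> The vertical support line at an end point \<open>e\<close> is angular iff \<open>\<phi>\<^sub>1 e = \<phi>\<^sub>2 e\<close> and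
  the chords from this point have bounded slope (\<open>angular_iff_corner\<close>). Where this fails,
  the diamonds above exist for every \<open>R\<close>, and the supremum is infinite.
\<close>

section \<open>One-sided derivatives of convex functions of one variable\<close>

lemma convex_slope_mono:
  fixes f :: "real \<Rightarrow> real"
  assumes f: "convex_on I f" and I: "x \<in> I" "s \<in> I" "t \<in> I" and "s \<noteq> x" "t \<noteq> x" "s \<le> t"
  shows "(f s - f x) / (s - x) \<le> (f t - f x) / (t - x)"
proof -
  have q: "(f r - f x) / (r - x) = (f x - f r) / (x - r)" for r
    by (metis minus_diff_eq minus_divide_divide)
  consider "s = t" | "x < s" "s < t" | "s < x" "x < t" | "s < t" "t < x"
    using assms(5-7) by linarith
  then show ?thesis
  proof cases
    case 2
    then show ?thesis
      using convex_on_slope_le(1)[OF f I(1) I(3), of s] unfolding q[of s] q[of t] by blast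
  next
    case 3
    then show ?thesis
      using order_trans[OF convex_on_slope_le[OF f I(2) I(3), of x]] unfolding q[of t] by blast
  next
    case 4
    then show ?thesis
      using convex_on_slope_le(2)[OF f I(2) I(1), of t] by blast
  qed simp
qed

text \<open>The difference quotients are monotone, so a one-sided bound suffices for convergence. The point
  \<open>x\<close> may be an end point of \<open>I\<close>.\<close>

lemma convex_right_derivative:
  fixes f :: "real \<Rightarrow> real"
  assumes f: "convex_on I f" and x: "x \<in> I" and U: "open U" "x \<in> U" "U \<inter> {x<..} \<subseteq> I"
    and bound: "\<And>t. t \<in> I \<Longrightarrow> x < t \<Longrightarrow> k \<le> (f t - f x) / (t - x)"
  obtains d where "((\<lambda>t. (f t - f x) / (t - x)) \<longlongrightarrow> d) (at_right x)"
    and "\<And>t. t \<in> I \<Longrightarrow> x < t \<Longrightarrow> d \<le> (f t - f x) / (t - x)"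
proof -
  let ?q = "\<lambda>t. (f t - f x) / (t - x)"
  have mono: "?q s \<le> ?q t" if "s \<in> I" "t \<in> I" "x < s" "s \<le> t" for s t
    using convex_slope_mono[OF f x] that by auto
  have lim: "(?q \<longlongrightarrow> Inf (?q ` ({x<..} \<inter> I))) (at x within ({x<..} \<inter> I))"
    using mono bound by (rule Lim_right_bound)
  have at: "at x within ({x<..} \<inter> I) = at_right x"
    using U by (intro at_within_nhd[of x U]) auto
  have le: "Inf (?q ` ({x<..} \<inter> I)) \<le> ?q t" if "t \<in> I" "x < t" for t
    using that bound by (intro cInf_lower bdd_belowI2) auto
  show ?thesis using that[OF lim[unfolded at] le] .
qed

lemma convex_left_derivative:
  fixes f :: "real \<Rightarrow> real"
  assumes f: "convex_on I f" and x: "x \<in> I" and U: "open U" "x \<in> U" "U \<inter> {..<x} \<subseteq> I"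
    and bound: "\<And>t. t \<in> I \<Longrightarrow> t < x \<Longrightarrow> (f t - f x) / (t - x) \<le> k"
  obtains d where "((\<lambda>t. (f t - f x) / (t - x)) \<longlongrightarrow> d) (at_left x)"
    and "\<And>t. t \<in> I \<Longrightarrow> t < x \<Longrightarrow> (f t - f x) / (t - x) \<le> d"
proof -
  let ?q = "\<lambda>t. (f t - f x) / (t - x)"
  have mono: "?q s \<le> ?q t" if "s \<in> I" "t \<in> I" "t < x" "s \<le> t" for s t
    using convex_slope_mono[OF f x] that by auto
  have lim: "(?q \<longlongrightarrow> Sup (?q ` ({..<x} \<inter> I))) (at x within ({..<x} \<inter> I))"
    using mono bound by (rule Lim_left_bound)
  have at: "at x within ({..<x} \<inter> I) = at_left x"
    using U by (intro at_within_nhd[of x U]) auto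
  have le: "?q t \<le> Sup (?q ` ({..<x} \<inter> I))" if "t \<in> I" "t < x" for t
    using that bound by (intro cSup_upper bdd_aboveI2) auto
  show ?thesis using that[OF lim[unfolded at] le] .
qed

lemma convex_one_sided_derivatives:
  fixes f :: "real \<Rightarrow> real"
  assumes f: "convex_on I f" and I: "open I" and x: "x \<in> I"
  obtains dl dr where "((\<lambda>t. (f t - f x) / (t - x)) \<longlongrightarrow> dl) (at_left x)"
    and "((\<lambda>t. (f t - f x) / (t - x)) \<longlongrightarrow> dr) (at_right x)"
    and "\<And>t. t \<in> I \<Longrightarrow> t < x \<Longrightarrow> (f t - f x) / (t - x) \<le> dl"
    and "\<And>t. t \<in> I \<Longrightarrow> x < t \<Longrightarrow> dr \<le> (f t - f x) / (t - x)"
    and "dl \<le> dr"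
proof -
  obtain e where e: "e > 0" "ball x e \<subseteq> I" using openE[OF I x] .
  then have "x - e / 2 \<in> ball x e" "x + e / 2 \<in> ball x e" by (simp_all add: dist_real_def)
  then have k: "x - e / 2 \<in> I" "x + e / 2 \<in> I" "x - e / 2 \<noteq> x" "x + e / 2 \<noteq> x"
    using e by auto
  have lower: "(f (x - e / 2) - f x) / (x - e / 2 - x) \<le> (f t - f x) / (t - x)" if "t \<in> I" "x < t" for t
    using that e(1) by (intro convex_slope_mono[OF f x k(1)]) auto
  have upper: "(f t - f x) / (t - x) \<le> (f (x + e / 2) - f x) / (x + e / 2 - x)" if "t \<in> I" "t < x" for t
    using that e(1) by (intro convex_slope_mono[OF f x _ k(2)]) auto
  obtain dr where dr: "((\<lambda>t. (f t - f x) / (t - x)) \<longlongrightarrow> dr) (at_right x)"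
    "\<And>t. t \<in> I \<Longrightarrow> x < t \<Longrightarrow> dr \<le> (f t - f x) / (t - x)"
    using convex_right_derivative[OF f x I x Int_lower1 lower] by blast
  obtain dl where dl: "((\<lambda>t. (f t - f x) / (t - x)) \<longlongrightarrow> dl) (at_left x)"
    "\<And>t. t \<in> I \<Longrightarrow> t < x \<Longrightarrow> (f t - f x) / (t - x) \<le> dl"
    using convex_left_derivative[OF f x I x Int_lower1 upper] by blast
  have ev: "eventually (\<lambda>s. s \<in> I) (at x within S)" for S
    using I x eventually_at_topological by blast
  have less: "eventually (\<lambda>s. s < x) (at_left x)" "eventually (\<lambda>s. x < s) (at_right x)"
    by (simp_all add: eventually_at_filter)
  have le: "dl \<le> (f t - f x) / (t - x)" if "t \<in> I" "x < t" for t
  proof (rule tendsto_upperbound[OF dl(1)])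
    show "eventually (\<lambda>s. (f s - f x) / (s - x) \<le> (f t - f x) / (t - x)) (at_left x)"
      using ev[of "{..<x}"] less(1)
      by eventually_elim (use that in \<open>auto intro!: convex_slope_mono[OF f x]\<close>)
  qed simp
  have "eventually (\<lambda>t. dl \<le> (f t - f x) / (t - x)) (at_right x)"
    using ev[of "{x<..}"] less(2) by eventually_elim (use le in auto)
  then have "dl \<le> dr"
    by (intro tendsto_lowerbound[OF dr(1)]) auto
  with that dl dr show ?thesis by blast
qed

lemma differentiable_if_one_sided:
  fixes f :: "real \<Rightarrow> real"
  assumes "((\<lambda>t. (f t - f x) / (t - x)) \<longlongrightarrow> d) (at_right x)"
    and "((\<lambda>t. (f t - f x) / (t - x)) \<longlongrightarrow> d) (at_left x)"
  shows "f differentiable (at x)"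
  using assms filterlim_split_at[of "\<lambda>t. (f t - f x) / (t - x)" "nhds d" x]
  unfolding real_differentiable_def has_field_derivative_iff by blast

text \<open>At a kink there is a rational slope \<open>r\<close> strictly between the one-sided derivatives, and then
  \<open>f t - r t\<close> has its strict minimum at the kink. Different kinks therefore have different slopes.\<close>

lemma convex_countable_nondifferentiable:
  fixes f :: "real \<Rightarrow> real"
  assumes f: "convex_on I f" and I: "open I"
  shows "countable {x \<in> I. \<not> f differentiable (at x)}"
proof -
  have "\<exists>r. \<forall>t\<in>I. t \<noteq> x \<longrightarrow> f t > f x + real_of_rat r * (t - x)"
    if x: "x \<in> I" and nd: "\<not> f differentiable (at x)" for x
  proof -
    obtain dl dr where d: "((\<lambda>t. (f t - f x) / (t - x)) \<longlongrightarrow> dl) (at_left x)"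
      "((\<lambda>t. (f t - f x) / (t - x)) \<longlongrightarrow> dr) (at_right x)"
      and dl: "\<And>t. t \<in> I \<Longrightarrow> t < x \<Longrightarrow> (f t - f x) / (t - x) \<le> dl"
      and dr: "\<And>t. t \<in> I \<Longrightarrow> x < t \<Longrightarrow> dr \<le> (f t - f x) / (t - x)"
      and "dl \<le> dr"
      using convex_one_sided_derivatives[OF f I x] by blast
    moreover have "dl \<noteq> dr" using differentiable_if_one_sided nd d by blast
    ultimately obtain r where r: "dl < real_of_rat r" "real_of_rat r < dr"
      using of_rat_dense[of dl dr] by auto
    have "f t > f x + real_of_rat r * (t - x)" if "t \<in> I" "t \<noteq> x" for t
    proof (cases "t < x")
      case True
      then have "(f t - f x) / (t - x) < real_of_rat r" using dl[of t] that r by auto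
      then show ?thesis using True by (simp add: divide_less_eq)
    next
      case False
      then have "real_of_rat r < (f t - f x) / (t - x)" using dr[of t] that r by auto
      then show ?thesis using False that by (simp add: less_divide_eq)
    qed
    then show ?thesis by blast
  qed
  then obtain r where r: "\<And>x t. \<lbrakk>x \<in> I; \<not> f differentiable (at x); t \<in> I; t \<noteq> x\<rbrakk>
      \<Longrightarrow> f t > f x + real_of_rat (r x) * (t - x)"
    by metis
  have "inj_on r {x \<in> I. \<not> f differentiable (at x)}"
  proof (rule inj_onI, rule ccontr)
    fix x y assume *: "x \<in> {x \<in> I. \<not> f differentiable (at x)}"
      "y \<in> {x \<in> I. \<not> f differentiable (at x)}" "r x = r y" "x \<noteq> y"
    show False using r[of x y] r[of y x] * by (auto simp: algebra_simps)
  qed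
  then show ?thesis using countableI' countableI_type countable_image_inj_on by blast
qed

text \<open>For a convex function differentiability at a point can be read off from a single sequence of
  difference quotients. This is what makes the set of points of differentiability measurable in
  the plane.\<close>

lemma convex_differentiable_iff_second_difference:
  fixes f :: "real \<Rightarrow> real"
  assumes f: "convex_on I f" and I: "open I" and x: "x \<in> I"
  shows "f differentiable (at x) \<longleftrightarrow>
    (\<lambda>n. real (Suc n) * (f (x + 1 / real (Suc n)) + f (x - 1 / real (Suc n)) - 2 * f x)) \<longlonglongrightarrow> 0"
proof -
  obtain dl dr where dl: "((\<lambda>t. (f t - f x) / (t - x)) \<longlongrightarrow> dl) (at_left x)"
    and dr: "((\<lambda>t. (f t - f x) / (t - x)) \<longlongrightarrow> dr) (at_right x)"
    using convex_one_sided_derivatives[OF f I x] by metis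
  have "filterlim (\<lambda>n. x + 1 / real (Suc n)) (at_right x) sequentially"
    using LIMSEQ_inverse_real_of_nat_add[of x] unfolding filterlim_at
    by (simp add: inverse_eq_divide add_pos_nonneg less_imp_neq[THEN not_sym])
  from filterlim_compose[OF dr this]
  have R: "(\<lambda>n. real (Suc n) * (f (x + 1 / real (Suc n)) - f x)) \<longlonglongrightarrow> dr"
    by (simp add: mult.commute)
  have "filterlim (\<lambda>n. x - 1 / real (Suc n)) (at_left x) sequentially"
    using LIMSEQ_inverse_real_of_nat_add_minus[of x] unfolding filterlim_at
    by (simp add: inverse_eq_divide add_pos_nonneg less_imp_neq[THEN not_sym])
  from filterlim_compose[OF dl this]
  have "(\<lambda>n. - (real (Suc n) * (f (x - 1 / real (Suc n)) - f x))) \<longlonglongrightarrow> dl"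
    by (simp add: mult.commute)
  from tendsto_diff[OF R this]
  have lim: "(\<lambda>n. real (Suc n) * (f (x + 1 / real (Suc n)) + f (x - 1 / real (Suc n)) - 2 * f x))
      \<longlonglongrightarrow> dr - dl"
    by (simp add: algebra_simps)
  show ?thesis
  proof
    assume "f differentiable (at x)"
    then obtain D where "((\<lambda>t. (f t - f x) / (t - x)) \<longlongrightarrow> D) (at x)"
      unfolding real_differentiable_def has_field_derivative_iff by blast
    then have "((\<lambda>t. (f t - f x) / (t - x)) \<longlongrightarrow> D) (at_right x)"
      "((\<lambda>t. (f t - f x) / (t - x)) \<longlongrightarrow> D) (at_left x)"
      by (auto simp: filterlim_at_split)
    then have "dr = D" "dl = D"
      using dr dl tendsto_unique trivial_limit_at_right_real trivial_limit_at_left_real by blast+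
    then show "(\<lambda>n. real (Suc n) * (f (x + 1 / real (Suc n)) + f (x - 1 / real (Suc n)) - 2 * f x)) \<longlonglongrightarrow> 0"
      using lim by simp
  next
    assume "(\<lambda>n. real (Suc n) * (f (x + 1 / real (Suc n)) + f (x - 1 / real (Suc n)) - 2 * f x)) \<longlonglongrightarrow> 0"
    then have "dr = dl" using LIMSEQ_unique[OF lim] by fastforce
    then show "f differentiable (at x)"
      using differentiable_if_one_sided dr dl by blast
  qed
qed

section \<open>Partial derivatives of a concave function\<close>

text \<open>The partial derivatives with respect to \<open>x\<close> and \<open>y\<close> are treated simultaneously, as derivatives
  in the direction \<open>e = (1, 0)\<close> or \<open>e = (0, 1)\<close>.\<close>

definition dir_deriv :: "plane \<Rightarrow> (plane \<Rightarrow> real) \<Rightarrow> plane \<Rightarrow> real" where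
  "dir_deriv e u p = deriv (\<lambda>s. u (p + s *\<^sub>R e)) 0"

definition dir_differentiable :: "plane \<Rightarrow> (plane \<Rightarrow> real) \<Rightarrow> plane \<Rightarrow> bool" where
  "dir_differentiable e u p \<longleftrightarrow> (\<lambda>s. u (p + s *\<^sub>R e)) differentiable (at 0)"

lemma deriv_eq_deriv_at_0: "deriv g s = deriv (\<lambda>h. g (s + h)) (0::real)"
  unfolding deriv_def using DERIV_shift[of g _ 0 s] by (simp add: add.commute)

lemma differentiable_iff_at_0:
  "(g::real \<Rightarrow> real) differentiable (at s) \<longleftrightarrow> (\<lambda>h. g (s + h)) differentiable (at 0)"
  unfolding real_differentiable_def using DERIV_shift[of g _ 0 s] by (simp add: add.commute)

lemma partial_x_eq: "partial_x u = dir_deriv (1, 0) u"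
  unfolding partial_x_def dir_deriv_def
  by (rule ext, subst deriv_eq_deriv_at_0) (simp add: plus_prod_def)

lemma partial_y_eq: "partial_y u = dir_deriv (0, 1) u"
  unfolding partial_y_def dir_deriv_def
  by (rule ext, subst deriv_eq_deriv_at_0) (simp add: plus_prod_def)

lemma has_gradient_iff:
  "has_gradient u p \<longleftrightarrow> dir_differentiable (1, 0) u p \<and> dir_differentiable (0, 1) u p"
  unfolding has_gradient_def dir_differentiable_def
  by (subst (1 2) differentiable_iff_at_0) (simp add: plus_prod_def)

locale concave_on_domain =
  fixes \<Omega> :: "plane set" and u :: "plane \<Rightarrow> real"
  assumes dom: "convex_compact_domain \<Omega>"
    and cont: "continuous_on \<Omega> u"
    and conc: "concave_on \<Omega> u"
begin

lemma compact: "compact \<Omega>" and convex: "convex \<Omega>" and interior_nonempty: "interior \<Omega> \<noteq> {}"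
  using dom by (auto simp: convex_compact_domain_def)

lemma convex_along_line:
  shows "open {s. p + s *\<^sub>R e \<in> interior \<Omega>}"
    and "convex_on {s. p + s *\<^sub>R e \<in> interior \<Omega>} (\<lambda>s. - u (p + s *\<^sub>R e))"
proof -
  have "open ((\<lambda>s. p + s *\<^sub>R e) -` interior \<Omega>)"
    by (intro open_vimage continuous_intros) auto
  then show "open {s. p + s *\<^sub>R e \<in> interior \<Omega>}" by (simp add: vimage_def)
  have aff: "p + ((1 - t) *\<^sub>R x + t *\<^sub>R y) *\<^sub>R e = (1 - t) *\<^sub>R (p + x *\<^sub>R e) + t *\<^sub>R (p + y *\<^sub>R e)" for t x y :: real
    by (simp add: algebra_simps)
  show "convex_on {s. p + s *\<^sub>R e \<in> interior \<Omega>} (\<lambda>s. - u (p + s *\<^sub>R e))"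
  proof (rule convex_onI)
    show "convex {s. p + s *\<^sub>R e \<in> interior \<Omega>}"
      using convexD_alt[OF convex_interior[OF convex]] unfolding convex_alt mem_Collect_eq aff by auto
    fix t x y :: real
    assume *: "0 < t" "t < 1" "x \<in> {s. p + s *\<^sub>R e \<in> interior \<Omega>}" "y \<in> {s. p + s *\<^sub>R e \<in> interior \<Omega>}"
    then have "p + x *\<^sub>R e \<in> \<Omega>" "p + y *\<^sub>R e \<in> \<Omega>" using interior_subset by auto
    with * show "- u (p + ((1 - t) *\<^sub>R x + t *\<^sub>R y) *\<^sub>R e) \<le> (1 - t) * - u (p + x *\<^sub>R e) + t * - u (p + y *\<^sub>R e)"
      unfolding aff using concave_onD[OF conc, of t] by (smt (verit) mult_minus_right)
  qed
qed

text \<open>Extending \<open>u\<close> by zero gives a Borel function on the plane; near interior points the difference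
  quotients do not see the change.\<close>

definition ext0 :: "plane \<Rightarrow> real" where
  "ext0 p = indicator \<Omega> p *\<^sub>R u p"

definition second_difference :: "plane \<Rightarrow> plane \<Rightarrow> nat \<Rightarrow> real" where
  "second_difference e p n = real (Suc n) *
     (ext0 (p + (1 / real (Suc n)) *\<^sub>R e) + ext0 (p - (1 / real (Suc n)) *\<^sub>R e) - 2 * ext0 p)"

lemma ext0_measurable [measurable]: "ext0 \<in> borel_measurable borel"
  unfolding ext0_def [abs_def]
  by (intro borel_measurable_continuous_on_indicator cont borel_closed compact_imp_closed compact)

lemma eventually_interior:
  assumes "p \<in> interior \<Omega>" and "s \<longlonglongrightarrow> (0::real)"
  shows "eventually (\<lambda>n. p + s n *\<^sub>R e \<in> interior \<Omega>) sequentially"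
proof -
  have "(\<lambda>n. p + s n *\<^sub>R e) \<longlonglongrightarrow> p + 0 *\<^sub>R e"
    by (intro tendsto_intros assms)
  then show ?thesis using assms(1) topological_tendstoD[OF _ open_interior] by fastforce
qed

lemma step_tendsto_0: "(\<lambda>n. 1 / real (Suc n)) \<longlonglongrightarrow> 0" "(\<lambda>n. - (1 / real (Suc n))) \<longlonglongrightarrow> 0"
  using LIMSEQ_inverse_real_of_nat tendsto_minus[OF LIMSEQ_inverse_real_of_nat]
  by (simp_all add: inverse_eq_divide)

lemma dir_differentiable_iff:
  assumes p: "p \<in> interior \<Omega>"
  shows "dir_differentiable e u p \<longleftrightarrow> second_difference e p \<longlonglongrightarrow> 0"
proof -
  let ?f = "\<lambda>s. - u (p + s *\<^sub>R e)" and ?h = "\<lambda>n. 1 / real (Suc n)"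
  have "dir_differentiable e u p \<longleftrightarrow> ?f differentiable (at 0)"
    unfolding dir_differentiable_def
    using differentiable_minus[of ?f] differentiable_minus[of "\<lambda>s. u (p + s *\<^sub>R e)"] by fastforce
  also have "\<dots> \<longleftrightarrow> (\<lambda>n. real (Suc n) * (?f (0 + ?h n) + ?f (0 - ?h n) - 2 * ?f 0)) \<longlonglongrightarrow> 0"
    using convex_along_line[of p e] p by (intro convex_differentiable_iff_second_difference) auto
  also have "\<dots> \<longleftrightarrow> (\<lambda>n. - second_difference e p n) \<longlonglongrightarrow> 0"
  proof (rule tendsto_cong)
    show "eventually (\<lambda>n. real (Suc n) * (?f (0 + ?h n) + ?f (0 - ?h n) - 2 * ?f 0)
        = - second_difference e p n) sequentially"
      using eventually_interior[OF p step_tendsto_0(1), of e] eventually_interior[OF p step_tendsto_0(2), of e]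
    proof eventually_elim
      case (elim n)
      then show ?case using p interior_subset[of \<Omega>]
        by (auto simp: second_difference_def ext0_def indicator_def algebra_simps)
    qed
  qed
  also have "\<dots> \<longleftrightarrow> second_difference e p \<longlonglongrightarrow> 0"
    using tendsto_minus_cancel_left[of "second_difference e p" 0] by simp
  finally show ?thesis .
qed

text \<open>On each line in direction \<open>e\<close> the exceptional points are countable, so Fubini's theorem applies
  once the exceptional set is known to be Borel. For \<open>e = (1, 0)\<close> the order of integration has to
  be exchanged.\<close>

lemma AE_dir_differentiable:
  assumes e: "e = (1, 0) \<or> e = (0, 1)"
  shows "AE p in lebesgue. p \<in> interior \<Omega> \<longrightarrow> dir_differentiable e u p"
proof -
  let ?P = "\<lambda>p. p \<in> interior \<Omega> \<longrightarrow> second_difference e p \<longlonglongrightarrow> 0"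
  have [measurable]: "(\<lambda>p. second_difference e p n) \<in> borel_measurable borel" for n
    unfolding second_difference_def by measurable
  have [measurable]: "interior \<Omega> \<in> sets borel" by simp
  have [measurable]: "Measurable.pred borel (\<lambda>p. second_difference e p \<longlonglongrightarrow> 0)"
    by (rule measurable_limit) measurable
  have "{p \<in> space borel. ?P p} \<in> sets borel"
    by measurable
  then have meas: "{p \<in> space (lborel \<Otimes>\<^sub>M lborel). ?P p} \<in> sets (lborel \<Otimes>\<^sub>M lborel)"
    unfolding lborel_prod by simp
  have line: "AE s in lborel. ?P (q + s *\<^sub>R e)" for q
  proof -
    let ?f = "\<lambda>s. - u (q + s *\<^sub>R e)" and ?I = "{s. q + s *\<^sub>R e \<in> interior \<Omega>}"
    have "AE s in lborel. s \<notin> {s \<in> ?I. \<not> ?f differentiable (at s)}"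
      using convex_along_line[of q e]
      by (intro AE_not_in countable_imp_null_set_lborel convex_countable_nondifferentiable)
    then show ?thesis
    proof (rule AE_mp, intro AE_I2 impI)
      fix s assume s: "s \<notin> {s \<in> ?I. \<not> ?f differentiable (at s)}" "q + s *\<^sub>R e \<in> interior \<Omega>"
      then have "?f differentiable (at s)" by blast
      then have "(\<lambda>h. - ?f (s + h)) differentiable (at 0)"
        unfolding differentiable_iff_at_0[of ?f s] by (rule differentiable_minus)
      then have "dir_differentiable e u (q + s *\<^sub>R e)"
        unfolding dir_differentiable_def by (simp add: scaleR_left_distrib add.assoc)
      then show "second_difference e (q + s *\<^sub>R e) \<longlonglongrightarrow> 0" using dir_differentiable_iff s by blast
    qed
  qed
  have "AE p in lborel \<Otimes>\<^sub>M lborel. ?P p"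
  proof (rule lborel_pair.AE_pair_measure[OF meas])
    show "AE x in lborel. AE y in lborel. ?P (x, y)"
    proof (cases "e = (0, 1)")
      case True
      then show ?thesis using line[of "(_, 0)"] by (simp add: plus_prod_def)
    next
      case False
      then have "AE y in lborel. AE x in lborel. ?P (x, y)"
        using e line[of "(0, _)"] by (simp add: plus_prod_def)
      then show ?thesis
        using lborel_pair.AE_commute[of "\<lambda>x y. ?P (x, y)"] meas by simp
    qed
  qed
  then have "AE p in lborel. ?P p" unfolding lborel_prod .
  then have "AE p in lebesgue. ?P p" by (rule AE_completion)
  then show ?thesis by eventually_elim (simp add: dir_differentiable_iff)
qed

lemma AE_interior: "AE p in lebesgue. p \<in> \<Omega> \<longrightarrow> p \<in> interior \<Omega>"
proof -
  have "AE p in lebesgue. p \<notin> frontier \<Omega>"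
    using negligible_convex_frontier[OF convex] by (intro AE_not_in) (simp add: negligible_iff_null_sets)
  then show ?thesis
    by eventually_elim (use closure_subset in \<open>auto simp: frontier_def\<close>)
qed

lemma AE_lebesgue_on_iff: "(AE p in lebesgue_on \<Omega>. P p) \<longleftrightarrow> (AE p in lebesgue. p \<in> \<Omega> \<longrightarrow> P p)"
  using lmeasurable_compact[OF compact] by (intro AE_restrict_space_iff) (auto simp: fmeasurable_def)

text \<open>Almost everywhere the derivative is the limit of a sequence of Borel functions; completeness
  of the Lebesgue measure takes care of the remaining points.\<close>

lemma dir_deriv_measurable:
  assumes e: "e = (1, 0) \<or> e = (0, 1)"
  shows "dir_deriv e u \<in> borel_measurable (lebesgue_on \<Omega>)"
proof -
  let ?F = "\<lambda>n p. real (Suc n) * (ext0 (p + (1 / real (Suc n)) *\<^sub>R e) - ext0 p)"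
  let ?g = "\<lambda>p. indicator (interior \<Omega>) p * lim (\<lambda>n. ?F n p)"
  have "?g \<in> borel_measurable borel"
    by (intro borel_measurable_times borel_measurable_lim_metric) measurable
  then have meas: "?g \<in> borel_measurable lebesgue"
    by (simp add: measurable_completion)
  have "AE p in lebesgue. ?g p = (if p \<in> \<Omega> then dir_deriv e u p else 0)"
    using AE_dir_differentiable[OF e] AE_interior
  proof eventually_elim
    case (elim p)
    show ?case
    proof (cases "p \<in> interior \<Omega>")
      case True
      let ?v = "\<lambda>s. u (p + s *\<^sub>R e)"
      have "(?v has_field_derivative dir_deriv e u p) (at 0)"
        using elim True unfolding dir_differentiable_def dir_deriv_def
        by (metis DERIV_imp_deriv real_differentiable_def)
      then have "((\<lambda>s. (?v s - ?v 0) / (s - 0)) \<longlongrightarrow> dir_deriv e u p) (at 0)"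
        unfolding has_field_derivative_iff .
      moreover have "filterlim (\<lambda>n. 1 / real (Suc n)) (at 0) sequentially"
        unfolding filterlim_at using step_tendsto_0(1) by simp
      ultimately have "(\<lambda>n. (?v (1 / real (Suc n)) - ?v 0) / (1 / real (Suc n) - 0)) \<longlonglongrightarrow> dir_deriv e u p"
        by (rule filterlim_compose)
      moreover have "eventually (\<lambda>n. (?v (1 / real (Suc n)) - ?v 0) / (1 / real (Suc n) - 0) = ?F n p) sequentially"
        using eventually_interior[OF True step_tendsto_0(1), of e]
      proof eventually_elim
        case (elim n)
        then show ?case using True interior_subset[of \<Omega>]
          by (auto simp: ext0_def indicator_def algebra_simps)
      qed
      ultimately have "(\<lambda>n. ?F n p) \<longlonglongrightarrow> dir_deriv e u p"
        using tendsto_cong by fastforce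
      then show ?thesis using True interior_subset by (auto dest: limI)
    next
      case False
      then show ?thesis using elim by auto
    qed
  qed
  from borel_measurable_AE[OF meas this]
  have "(\<lambda>p. if p \<in> \<Omega> then dir_deriv e u p else 0) \<in> borel_measurable (lebesgue_on \<Omega>)"
    by (rule measurable_restrict_space1)
  then show ?thesis
    by (rule measurable_cong[THEN iffD1, rotated]) (simp add: space_restrict_space)
qed

text \<open>Only points at which both partial derivatives exist need to be considered: this is the form in
  which the class of functions bounds the gradient.\<close>

lemma sup_norm_le:
  assumes e: "e = (1, 0) \<or> e = (0, 1)"
    and b: "\<And>p. p \<in> interior \<Omega> \<Longrightarrow> dir_differentiable (1, 0) u p \<Longrightarrow> dir_differentiable (0, 1) u p
      \<Longrightarrow> \<bar>dir_deriv e u p\<bar> \<le> c"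
  shows "sup_norm \<Omega> (dir_deriv e u) \<le> ereal c"
  unfolding sup_norm_def
proof (rule esssup_I)
  show "(\<lambda>p. ereal \<bar>dir_deriv e u p\<bar>) \<in> borel_measurable (lebesgue_on \<Omega>)"
    using dir_deriv_measurable[OF e] by measurable
  show "AE p in lebesgue_on \<Omega>. ereal \<bar>dir_deriv e u p\<bar> \<le> ereal c"
    unfolding AE_lebesgue_on_iff
    using AE_interior AE_dir_differentiable[OF disjI1[OF refl]] AE_dir_differentiable[OF disjI2[OF refl]]
    by eventually_elim (use b in auto)
qed

text \<open>The essential supremum is taken over a set of positive measure, as the interior of \<open>\<Omega>\<close> is not
  empty.\<close>

lemma sup_norm_nonneg: "0 \<le> sup_norm \<Omega> f"
proof (rule ccontr)
  assume "\<not> 0 \<le> sup_norm \<Omega> f"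
  moreover have "AE p in lebesgue_on \<Omega>. ereal \<bar>f p\<bar> \<le> sup_norm \<Omega> f"
    unfolding sup_norm_def by (rule esssup_AE)
  ultimately have "AE p in lebesgue_on \<Omega>. False"
    by (auto elim!: eventually_mono) (metis abs_ge_zero ereal_less_eq(5) order_trans)
  then have "AE p in lebesgue. p \<notin> \<Omega>"
    by (simp add: AE_lebesgue_on_iff)
  then have "\<Omega> \<in> null_sets lebesgue"
    by (subst AE_iff_null_sets) (auto intro: lmeasurable_compact[OF compact] fmeasurableD)
  then show False
    using negligible_convex_interior[OF convex] interior_nonempty by (simp add: negligible_iff_null_sets)
qed

lemma tangent_above:
  assumes diff: "dir_differentiable e u p" and p: "p \<in> interior \<Omega>" and q: "p + d *\<^sub>R e \<in> interior \<Omega>"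
  shows "u (p + d *\<^sub>R e) - u p \<le> dir_deriv e u p * d"
proof -
  let ?I = "{s. p + s *\<^sub>R e \<in> interior \<Omega>}"
  have "((\<lambda>s. u (p + s *\<^sub>R e)) has_field_derivative dir_deriv e u p) (at 0)"
    using diff unfolding dir_differentiable_def dir_deriv_def
    by (metis DERIV_imp_deriv real_differentiable_def)
  then have D: "((\<lambda>s. - u (p + s *\<^sub>R e)) has_field_derivative - dir_deriv e u p) (at 0 within ?I)"
    by (rule has_field_derivative_at_within[OF DERIV_minus])
  have conn: "connected ?I"
    using convex_on_imp_convex[OF convex_along_line(2)] by (rule convex_connected)
  have int: "0 \<in> interior ?I"
    using p by (simp add: interior_open[OF convex_along_line(1)])
  have "d \<in> ?I" using q by simp
  from convex_on_imp_above_tangent[OF convex_along_line(2) conn int this D]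
  show ?thesis by simp
qed

text \<open>If an increment over the step \<open>d e\<close> violates the bound at \<open>p\<close>, then by continuity the same step
  violates it at all points of a neighbourhood. One of them satisfies the almost everywhere bound on
  the derivative, and there the tangent line lies above \<open>u\<close>.\<close>

lemma Lipschitz_along_axis_interior:
  assumes e: "e = (1, 0) \<or> e = (0, 1)"
    and M: "sup_norm \<Omega> (dir_deriv e u) \<le> ereal M"
    and p: "p \<in> interior \<Omega>" and q: "p + d *\<^sub>R e \<in> interior \<Omega>"
  shows "u (p + d *\<^sub>R e) - u p \<le> M * \<bar>d\<bar>"
proof (rule ccontr)
  assume neg: "\<not> ?thesis"
  define V where "V = interior \<Omega> \<inter> (\<lambda>x. x + d *\<^sub>R e) -` interior \<Omega>"
  have "open V" unfolding V_def
    by (intro open_Int open_interior open_vimage continuous_intros)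
  have ui: "continuous_on (interior \<Omega>) u" using cont continuous_on_subset interior_subset by blast
  have "continuous_on V (\<lambda>x. u (x + d *\<^sub>R e) - u x)"
    unfolding V_def
    by (intro continuous_intros continuous_on_compose2[OF ui]) (auto intro: continuous_on_subset[OF ui])
  then obtain W where W: "open W" "W \<inter> V = (\<lambda>x. u (x + d *\<^sub>R e) - u x) -` {M * \<bar>d\<bar><..} \<inter> V"
    unfolding continuous_on_open_invariant by (meson open_greaterThan)
  have pW: "p \<in> W \<inter> V" using neg p q unfolding W(2) by (auto simp: V_def)
  have "AE x in lebesgue_on \<Omega>. ereal \<bar>dir_deriv e u x\<bar> \<le> ereal M"
    using esssup_AE by (rule eventually_mono) (rule order_trans[OF _ M[unfolded sup_norm_def]])
  then have "AE x in lebesgue. x \<in> \<Omega> \<longrightarrow> \<bar>dir_deriv e u x\<bar> \<le> M"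
    by (simp add: AE_lebesgue_on_iff)
  then have "AE x in lebesgue. x \<notin> W \<inter> V"
    using AE_dir_differentiable[OF e]
  proof eventually_elim
    case (elim x)
    show ?case
    proof
      assume x: "x \<in> W \<inter> V"
      then have xi: "x \<in> interior \<Omega>" "x + d *\<^sub>R e \<in> interior \<Omega>" by (auto simp: V_def)
      have big: "M * \<bar>d\<bar> < u (x + d *\<^sub>R e) - u x" using x W(2) by auto
      have "\<bar>dir_deriv e u x\<bar> \<le> M" using elim xi interior_subset by auto
      have "u (x + d *\<^sub>R e) - u x \<le> dir_deriv e u x * d"
        using elim xi by (intro tangent_above) auto
      also have "\<dots> \<le> \<bar>dir_deriv e u x\<bar> * \<bar>d\<bar>" by (metis abs_ge_self abs_mult)
      also have "\<dots> \<le> M * \<bar>d\<bar>" using \<open>\<bar>dir_deriv e u x\<bar> \<le> M\<close> by (intro mult_right_mono) auto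
      finally show False using big by simp
    qed
  qed
  then have "W \<inter> V \<in> null_sets lebesgue"
    using W(1) \<open>open V\<close> by (subst AE_iff_null_sets) auto
  then show False
    using open_not_negligible[of "W \<inter> V"] W(1) \<open>open V\<close> pW by (auto simp: negligible_iff_null_sets)
qed

text \<open>Shrinking \<open>\<Omega>\<close> towards an interior point \<open>c\<close> moves both points into the interior and keeps
  their difference parallel to \<open>e\<close>.\<close>

lemma Lipschitz_along_axis:
  assumes e: "e = (1, 0) \<or> e = (0, 1)"
    and M: "sup_norm \<Omega> (dir_deriv e u) \<le> ereal M"
    and p: "p \<in> \<Omega>" and q: "p + d *\<^sub>R e \<in> \<Omega>"
  shows "u (p + d *\<^sub>R e) - u p \<le> M * \<bar>d\<bar>"
proof -
  obtain c where c: "c \<in> interior \<Omega>" using interior_nonempty by blast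
  let ?p = "\<lambda>t. p - t *\<^sub>R (p - c)" and ?q = "\<lambda>t. (p + d *\<^sub>R e) - t *\<^sub>R ((p + d *\<^sub>R e) - c)"
  have pc: "((\<lambda>t. u (x - t *\<^sub>R (x - c))) \<longlongrightarrow> u x) (at_right 0)" if x: "x \<in> \<Omega>" for x
  proof -
    have "eventually (\<lambda>t. x - t *\<^sub>R (x - c) \<in> \<Omega>) (at_right 0)"
      unfolding eventually_at_right_field
      using mem_interior_convex_shrink[OF convex c x]
      by (intro exI[of _ 1]) (auto intro: subsetD[OF interior_subset])
    moreover have "((\<lambda>t. x - t *\<^sub>R (x - c)) \<longlongrightarrow> x) (at_right 0)"
      by (auto intro!: tendsto_eq_intros)
    ultimately show ?thesis
      using continuous_on_tendsto_compose[OF cont _ x] by blast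
  qed
  show ?thesis
  proof (rule tendsto_le)
    show "((\<lambda>t. u (?q t) - u (?p t)) \<longlongrightarrow> u (p + d *\<^sub>R e) - u p) (at_right 0)"
      by (intro tendsto_diff pc p q)
    show "((\<lambda>t. M * \<bar>(1 - t) * d\<bar>) \<longlongrightarrow> M * \<bar>d\<bar>) (at_right (0::real))"
      by (auto intro!: tendsto_eq_intros)
    show "eventually (\<lambda>t. u (?q t) - u (?p t) \<le> M * \<bar>(1 - t) * d\<bar>) (at_right 0)"
      unfolding eventually_at_right_field
    proof (intro exI[of _ 1] conjI allI impI)
      fix t :: real assume t: "0 < t" "t < 1"
      have eq: "?q t = ?p t + ((1 - t) * d) *\<^sub>R e" by (simp add: algebra_simps)
      have "?p t \<in> interior \<Omega>" "?q t \<in> interior \<Omega>"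
        using mem_interior_convex_shrink[OF convex c] p q t by auto
      then show "u (?q t) - u (?p t) \<le> M * \<bar>(1 - t) * d\<bar>"
        unfolding eq by (rule Lipschitz_along_axis_interior[OF e M])
    qed simp
  qed simp
qed

end

section \<open>The depth function of a convex domain\<close>

text \<open>The unit balls are diamonds with horizontal half-diagonal \<open>1 / R\<close> and vertical half-diagonal
  \<open>1\<close>, dual to the rectangle \<open>\<bar>u\<^sub>x\<bar> \<le> R\<close>, \<open>\<bar>u\<^sub>y\<bar> \<le> 1\<close> of admissible gradients.\<close>

definition diamond_norm :: "real \<Rightarrow> plane \<Rightarrow> real" where
  "diamond_norm R v = R * \<bar>fst v\<bar> + \<bar>snd v\<bar>"

definition depth :: "real \<Rightarrow> plane set \<Rightarrow> plane \<Rightarrow> real" where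
  "depth R \<Omega> p = (INF q\<in>- \<Omega>. diamond_norm R (p - q))"

lemma abs_deriv_le_Lipschitz:
  fixes f :: "real \<Rightarrow> real"
  assumes D: "(f has_field_derivative D) (at 0)"
    and L: "eventually (\<lambda>s. \<bar>f s - f 0\<bar> \<le> L * \<bar>s\<bar>) (at 0)"
  shows "\<bar>D\<bar> \<le> L"
proof (rule tendsto_upperbound)
  show "((\<lambda>s. \<bar>(f s - f 0) / (s - 0)\<bar>) \<longlongrightarrow> \<bar>D\<bar>) (at 0)"
    using D unfolding has_field_derivative_iff by (rule tendsto_rabs)
  have "eventually (\<lambda>s. s \<noteq> 0) (at (0::real))" by (simp add: eventually_at_filter)
  with L show "eventually (\<lambda>s. \<bar>(f s - f 0) / (s - 0)\<bar> \<le> L) (at 0)"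
    by eventually_elim (simp add: divide_le_eq)
qed simp

lemma diamond_norm_le: "0 \<le> R \<Longrightarrow> diamond_norm R v \<le> (R + 1) * norm v"
  using mult_left_mono[OF norm_fst_le[of "fst v" "snd v"], of R] norm_snd_le[of "snd v" "fst v"]
  by (simp add: diamond_norm_def algebra_simps)

context
  fixes \<Omega> :: "plane set" and R :: real
  assumes dom: "convex_compact_domain \<Omega>" and R: "R > 0"
begin

lemma domain_compact: "compact \<Omega>" and domain_convex: "convex \<Omega>"
  using dom by (auto simp: convex_compact_domain_def)

lemma depth_le: "q \<notin> \<Omega> \<Longrightarrow> depth R \<Omega> p \<le> diamond_norm R (p - q)"
  unfolding depth_def using R
  by (intro cINF_lower bdd_belowI2[of _ 0]) (auto simp: diamond_norm_def)

lemma depth_ge: "(\<And>q. q \<notin> \<Omega> \<Longrightarrow> r \<le> diamond_norm R (p - q)) \<Longrightarrow> r \<le> depth R \<Omega> p"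
proof -
  have "- \<Omega> \<noteq> {}"
    using compact_imp_bounded[OF domain_compact] not_bounded_UNIV[where 'a=plane] by (metis Compl_empty_eq double_complement)
  moreover assume "\<And>q. q \<notin> \<Omega> \<Longrightarrow> r \<le> diamond_norm R (p - q)"
  ultimately show ?thesis unfolding depth_def by (intro cINF_greatest) auto
qed

lemma depth_nonneg: "0 \<le> depth R \<Omega> p"
  using R by (intro depth_ge) (simp add: diamond_norm_def)

lemma depth_Lipschitz: "\<bar>depth R \<Omega> p - depth R \<Omega> p'\<bar> \<le> diamond_norm R (p - p')"
proof -
  have *: "depth R \<Omega> p - diamond_norm R (p - p') \<le> depth R \<Omega> p'" for p p'
  proof (rule depth_ge)
    fix q assume "q \<notin> \<Omega>"
    have "R * \<bar>fst (p - q)\<bar> \<le> R * (\<bar>fst (p - p')\<bar> + \<bar>fst (p' - q)\<bar>)"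
      using R by (intro mult_left_mono) auto
    then have "diamond_norm R (p - q) \<le> diamond_norm R (p - p') + diamond_norm R (p' - q)"
      by (simp add: diamond_norm_def algebra_simps)
    then show "depth R \<Omega> p - diamond_norm R (p - p') \<le> diamond_norm R (p' - q)"
      using depth_le[OF \<open>q \<notin> \<Omega>\<close>, of p] by simp
  qed
  have "diamond_norm R (p' - p) = diamond_norm R (p - p')"
    by (simp add: diamond_norm_def abs_minus_commute)
  then show ?thesis using *[of p p'] *[of p' p] by simp
qed

lemma depth_frontier:
  assumes "p \<in> frontier \<Omega>"
  shows "depth R \<Omega> p = 0"
proof -
  have "depth R \<Omega> p \<le> e" if "e > 0" for e
  proof -
    have "e / (R + 1) > 0" using that R by simp
    then obtain q where q: "q \<notin> \<Omega>" "dist p q < e / (R + 1)"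
      using assms unfolding frontier_straddle by blast
    have "depth R \<Omega> p \<le> diamond_norm R (p - q)" using depth_le[OF q(1)] .
    also have "\<dots> \<le> (R + 1) * dist p q"
      using diamond_norm_le[of R "p - q"] R by (simp add: dist_norm)
    also have "\<dots> \<le> e" using q(2) R by (simp add: field_simps)
    finally show ?thesis .
  qed
  then have "depth R \<Omega> p \<le> 0" by (metis field_le_epsilon add_0)
  then show ?thesis using depth_nonneg[of p] by simp
qed

text \<open>A convex combination of diamonds contained in \<open>\<Omega>\<close> is contained in \<open>\<Omega>\<close>, and it is the diamond
  whose centre and radius are the convex combinations of the centres and radii.\<close>

lemma depth_concave: "concave_on \<Omega> (depth R \<Omega>)"
  unfolding concave_on_iff
proof (intro conjI ballI allI impI)
  show "convex \<Omega>" by (rule domain_convex)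
  fix p p' :: plane and a b :: real
  assume pp: "p \<in> \<Omega>" "p' \<in> \<Omega>" and ab: "0 \<le> a" "0 \<le> b" "a + b = 1"
  let ?r = "depth R \<Omega> p" and ?r' = "depth R \<Omega> p'"
  let ?r'' = "a * ?r + b * ?r'"
  show "?r'' \<le> depth R \<Omega> (a *\<^sub>R p + b *\<^sub>R p')"
  proof (rule depth_ge, rule ccontr)
    fix q assume q: "q \<notin> \<Omega>" and less: "\<not> ?r'' \<le> diamond_norm R (a *\<^sub>R p + b *\<^sub>R p' - q)"
    define v where "v = q - (a *\<^sub>R p + b *\<^sub>R p')"
    define w where "w = (1 / ?r'') *\<^sub>R v"
    have hom: "diamond_norm R (c *\<^sub>R x) = \<bar>c\<bar> * diamond_norm R x" for c x
      by (simp add: diamond_norm_def abs_mult algebra_simps)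
    have "diamond_norm R v < ?r''"
      using less by (simp add: v_def diamond_norm_def abs_minus_commute)
    moreover have "0 \<le> diamond_norm R v" using R by (simp add: diamond_norm_def)
    ultimately have r'': "0 < ?r''" and w: "diamond_norm R w < 1"
      by (auto simp: w_def hom)
    \<comment> \<open>\<open>w\<close> is the offset of \<open>q\<close> from the centre, scaled to the unit diamond.\<close>
    have in_dom: "x + depth R \<Omega> x *\<^sub>R w \<in> \<Omega>" if "x \<in> \<Omega>" for x
    proof (cases "depth R \<Omega> x = 0")
      case False
      then have "diamond_norm R (depth R \<Omega> x *\<^sub>R w) < depth R \<Omega> x"
        using w depth_nonneg[of x] by (simp add: hom)
      then show ?thesis
        using depth_le[of "x + depth R \<Omega> x *\<^sub>R w" x] by (force simp: diamond_norm_def)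
    qed (use that in simp)
    have "a *\<^sub>R (p + ?r *\<^sub>R w) + b *\<^sub>R (p' + ?r' *\<^sub>R w) \<in> \<Omega>"
      using convexD[OF domain_convex in_dom in_dom] pp ab by blast
    moreover have "a *\<^sub>R (p + ?r *\<^sub>R w) + b *\<^sub>R (p' + ?r' *\<^sub>R w) = a *\<^sub>R p + b *\<^sub>R p' + ?r'' *\<^sub>R w"
      by (simp add: algebra_simps)
    moreover have "\<dots> = q"
      using r'' by (simp add: w_def v_def)
    ultimately show False using q by simp
  qed
qed

text \<open>A diamond is the convex hull of its four vertices, so only these have to be checked.\<close>

lemma depth_ge_vertices:
  assumes h: "(x + h, y) \<in> \<Omega>" "(x - h, y) \<in> \<Omega>" "(x, y + R * \<bar>h\<bar>) \<in> \<Omega>" "(x, y - R * \<bar>h\<bar>) \<in> \<Omega>"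
  shows "R * \<bar>h\<bar> \<le> depth R \<Omega> (x, y)"
proof (rule depth_ge, rule ccontr)
  fix q assume q: "q \<notin> \<Omega>" "\<not> R * \<bar>h\<bar> \<le> diamond_norm R ((x, y) - q)"
  obtain v w where v: "q = (x + v, y + w)"
    by (metis add_diff_cancel_left' diff_add_cancel prod.collapse)
  have less: "R * \<bar>v\<bar> + \<bar>w\<bar> < R * \<bar>h\<bar>" using q(2) by (simp add: v diamond_norm_def)
  moreover have "R * \<bar>v\<bar> \<ge> 0" "R * \<bar>h\<bar> \<ge> 0" using R by auto
  ultimately have pos: "R * \<bar>h\<bar> > 0" by linarith
  then have h0: "\<bar>h\<bar> > 0" by (metis R zero_less_mult_pos)
  define \<alpha> where "\<alpha> = \<bar>v\<bar> / \<bar>h\<bar>"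
  define \<beta> where "\<beta> = \<bar>w\<bar> / (R * \<bar>h\<bar>)"
  have ab: "0 \<le> \<alpha>" "0 \<le> \<beta>" using R by (auto simp: \<alpha>_def \<beta>_def)
  have "\<alpha> + \<beta> = (R * \<bar>v\<bar> + \<bar>w\<bar>) / (R * \<bar>h\<bar>)"
    using R h0 by (simp add: \<alpha>_def \<beta>_def field_simps)
  also have "\<dots> < 1" using less pos by simp
  finally have ab1: "\<alpha> + \<beta> < 1" .
  have mid: "(x, y) \<in> \<Omega>"
    using convexD[OF domain_convex h(1,2), of "1/2" "1/2"] by (simp add: field_simps)
  \<comment> \<open>The vertices of the quadrant that contains \<open>q\<close>.\<close>
  define P where "P = (if sgn v = sgn h then (x + h, y) else (x - h, y))"
  define Q where "Q = (x, y + sgn w * (R * \<bar>h\<bar>))"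
  have "P \<in> \<Omega>" using h by (simp add: P_def)
  moreover have "Q \<in> \<Omega>" using h mid by (simp add: Q_def sgn_real_def)
  ultimately have "\<alpha> *\<^sub>R P + \<beta> *\<^sub>R Q + (1 - \<alpha> - \<beta>) *\<^sub>R (x, y) \<in> convex hull {P, Q, (x, y)}"
    using ab ab1 unfolding convex_hull_3 by (intro CollectI exI[of _ \<alpha>] exI[of _ \<beta>] exI[of _ "1 - \<alpha> - \<beta>"]) auto
  moreover have "convex hull {P, Q, (x, y)} \<subseteq> \<Omega>"
    using \<open>P \<in> \<Omega>\<close> \<open>Q \<in> \<Omega>\<close> mid domain_convex by (intro hull_minimal) auto
  moreover have "\<alpha> *\<^sub>R P + \<beta> *\<^sub>R Q + (1 - \<alpha> - \<beta>) *\<^sub>R (x, y) = q"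
  proof -
    have a: "\<alpha> *\<^sub>R P + (1 - \<alpha>) *\<^sub>R (x, y) = (x + v, y)"
      using h0 by (auto simp: P_def \<alpha>_def abs_if sgn_real_def field_simps split: if_splits)
    have b: "\<beta> * (sgn w * (R * \<bar>h\<bar>)) = w"
    proof -
      have "\<beta> * (R * \<bar>h\<bar>) = \<bar>w\<bar>" using R h0 by (simp add: \<beta>_def)
      then have "sgn w * (\<beta> * (R * \<bar>h\<bar>)) = w" by (simp add: sgn_mult_abs)
      then show ?thesis by (simp only: mult.left_commute)
    qed
    from a have "\<alpha> * fst P + (1 - \<alpha>) * x = x + v" "\<alpha> * snd P + (1 - \<alpha>) * y = y"
      by (simp_all add: prod_eq_iff)
    moreover have "\<beta> * snd Q = \<beta> * y + w" using b by (simp add: Q_def distrib_left)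
    moreover have "\<beta> * fst Q = \<beta> * x" by (simp add: Q_def)
    ultimately have "\<alpha> * fst P + \<beta> * fst Q + (1 - \<alpha> - \<beta>) * x = x + v"
      "\<alpha> * snd P + \<beta> * snd Q + (1 - \<alpha> - \<beta>) * y = y + w"
      by algebra+
    then show ?thesis by (simp add: v prod_eq_iff)
  qed
  ultimately show False using q(1) by auto
qed

lemma depth_concave_on_domain: "concave_on_domain \<Omega> (depth R \<Omega>)"
proof
  show "continuous_on \<Omega> (depth R \<Omega>)"
    unfolding continuous_on_iff
  proof (intro ballI allI impI)
    fix p :: plane and e :: real assume "e > 0"
    have "dist (depth R \<Omega> q) (depth R \<Omega> p) < e" if "dist q p < e / (R + 1)" for q
    proof -
      have "dist (depth R \<Omega> q) (depth R \<Omega> p) \<le> diamond_norm R (q - p)"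
        using depth_Lipschitz[of q p] by (simp add: dist_real_def)
      also have "\<dots> \<le> (R + 1) * dist q p"
        using diamond_norm_le[of R "q - p"] R by (simp add: dist_norm)
      also have "\<dots> < e" using that R by (simp add: field_simps)
      finally show ?thesis .
    qed
    then show "\<exists>d>0. \<forall>q\<in>\<Omega>. dist q p < d \<longrightarrow> dist (depth R \<Omega> q) (depth R \<Omega> p) < e"
      using \<open>e > 0\<close> R by (intro exI[of _ "e / (R + 1)"]) auto
  qed
qed (use dom depth_concave in auto)

lemma dir_deriv_depth_le:
  assumes "dir_differentiable e (depth R \<Omega>) p"
  shows "\<bar>dir_deriv e (depth R \<Omega>) p\<bar> \<le> diamond_norm R e"
proof (rule abs_deriv_le_Lipschitz)
  show "((\<lambda>s. depth R \<Omega> (p + s *\<^sub>R e)) has_field_derivative dir_deriv e (depth R \<Omega>) p) (at 0)"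
    using assms unfolding dir_differentiable_def dir_deriv_def
    by (metis DERIV_imp_deriv real_differentiable_def)
  have "\<bar>depth R \<Omega> (p + s *\<^sub>R e) - depth R \<Omega> (p + 0 *\<^sub>R e)\<bar> \<le> diamond_norm R e * \<bar>s\<bar>" for s
    using depth_Lipschitz[of "p + s *\<^sub>R e" p] by (simp add: diamond_norm_def abs_mult algebra_simps)
  then show "eventually (\<lambda>s. \<bar>depth R \<Omega> (p + s *\<^sub>R e) - depth R \<Omega> (p + 0 *\<^sub>R e)\<bar> \<le> diamond_norm R e * \<bar>s\<bar>) (at 0)"
    by simp
qed

lemma depth_in_concave_class: "depth R \<Omega> \<in> concave_class \<Omega>"
proof -
  interpret concave_on_domain \<Omega> "depth R \<Omega>" by (rule depth_concave_on_domain)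
  have "norm (partial_x (depth R \<Omega>) p, partial_y (depth R \<Omega>) p) \<le> R + 1"
    if "has_gradient (depth R \<Omega>) p" for p
  proof -
    have "norm (partial_x (depth R \<Omega>) p, partial_y (depth R \<Omega>) p)
        \<le> \<bar>partial_x (depth R \<Omega>) p\<bar> + \<bar>partial_y (depth R \<Omega>) p\<bar>"
      using norm_Pair_le[of "partial_x (depth R \<Omega>) p" "partial_y (depth R \<Omega>) p"] by simp
    then show ?thesis
      using that dir_deriv_depth_le[of "(1, 0)" p] dir_deriv_depth_le[of "(0, 1)" p]
      by (simp add: has_gradient_iff partial_x_eq partial_y_eq diamond_norm_def)
  qed
  then show ?thesis
    unfolding concave_class_def using cont conc depth_frontier by (auto intro!: exI[of _ "R + 1"])
qed

text \<open>The diamond has centre \<open>(x + h, y)\<close> and radius \<open>R \<bar>h\<bar>\<close>, and \<open>(x, y)\<close> is one of its vertices.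
  From there to the centre the depth rises from \<open>0\<close> to \<open>R \<bar>h\<bar>\<close> over the horizontal distance
  \<open>\<bar>h\<bar>\<close>. A negative \<open>h\<close> covers frontier points on the right.\<close>

lemma K_inf_ge_if_diamond:
  assumes \<xi>: "(x, y) \<in> frontier \<Omega>" and "h \<noteq> 0"
    and h: "(x + 2 * h, y) \<in> \<Omega>" "(x + h, y + R * \<bar>h\<bar>) \<in> \<Omega>" "(x + h, y - R * \<bar>h\<bar>) \<in> \<Omega>"
  shows "ereal R \<le> K_inf \<Omega>"
proof -
  interpret concave_on_domain \<Omega> "depth R \<Omega>" by (rule depth_concave_on_domain)
  let ?u = "depth R \<Omega>"
  let ?N = "sup_norm \<Omega> (partial_x ?u)" and ?D = "sup_norm \<Omega> (partial_y ?u)"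
  have \<xi>': "(x, y) \<in> \<Omega>"
    using \<xi> frontier_subset_closed compact_imp_closed[OF compact] by blast
  have mid: "(x, y) + h *\<^sub>R (1, 0) \<in> \<Omega>"
    using convexD[OF convex \<xi>' h(1), of "1/2" "1/2"] by (simp add: add_divide_distrib)
  have low: "R * \<bar>h\<bar> \<le> ?u (x + h, y)"
    using \<xi>' h by (intro depth_ge_vertices) (auto simp: algebra_simps)
  have pos: "0 < R * \<bar>h\<bar>" using R \<open>h \<noteq> 0\<close> by simp
  have "ereal R \<le> ?N"
  proof (cases "?N")
    case (real M)
    have "?u ((x, y) + h *\<^sub>R (1, 0)) - ?u (x, y) \<le> M * \<bar>h\<bar>"
      using real by (intro Lipschitz_along_axis \<xi>' mid) (auto simp: partial_x_eq)
    then have "R * \<bar>h\<bar> \<le> M * \<bar>h\<bar>" using low depth_frontier[OF \<xi>] by simp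
    then show ?thesis using real \<open>h \<noteq> 0\<close> by simp
  qed (use sup_norm_nonneg[of "partial_x ?u"] in auto)
  also have "?N \<le> ?N / ?D"
  proof -
    have "?D \<le> 1"
      using sup_norm_le[of "(0, 1)" 1] dir_deriv_depth_le[of "(0, 1)"]
      by (simp add: partial_y_eq diamond_norm_def one_ereal_def)
    then have "inverse 1 \<le> inverse ?D"
      using sup_norm_nonneg by (intro ereal_inverse_antimono) auto
    then have "?N * 1 \<le> ?N * inverse ?D"
      using sup_norm_nonneg by (intro ereal_mult_left_mono) auto
    then show ?thesis by (simp add: divide_ereal_def)
  qed
  also have "\<dots> \<le> K_inf \<Omega>"
    unfolding K_inf_def
    using depth_in_concave_class mid low pos by (intro SUP_upper) (auto intro!: bexI[OF _ mid])
  finally show ?thesis .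
qed

end

section \<open>Domains between two graphs\<close>

text \<open>A chord of \<open>f\<close> that rises from the end point \<open>e\<close> with slope above \<open>R\<close> can be moved to start at a
  point \<open>x\<close> of the open interval without losing its slope, because \<open>f\<close> is upper semicontinuous at
  \<open>e\<close>. At \<open>x\<close> there is room below the graph of \<open>f\<close>, and concavity transfers the slope of the chord to
  its initial part. Hence a small diamond with vertex \<open>(x, f x)\<close> fits between the graphs. The
  statement is about two functions rather than a domain so that it also applies to the reflected
  domain, with \<open>- \<phi>\<^sub>1\<close> and \<open>- \<phi>\<^sub>2\<close> in the place of \<open>f\<close> and \<open>g\<close>.\<close>

lemma inner_diamond_at_graph:
  fixes f g :: "real \<Rightarrow> real"
  assumes f: "concave_on {a..b} f" and g: "convex_on {a..b} g"
    and closed: "closed {(x, y). x \<in> {a..b} \<and> g x \<le> y \<and> y \<le> f x}"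
    and strict: "\<And>x. x \<in> {a<..<b} \<Longrightarrow> g x < f x"
    and e: "e \<in> {a, b}" "g e \<le> f e" and t: "t \<in> {a..b}" and "R > 0"
    and steep: "f t - f e > R * \<bar>t - e\<bar>"
  obtains x h where "x \<in> {a..b}" "h \<noteq> 0" "x + 2 * h \<in> {a..b}" "x + h \<in> {a..b}"
    "g (x + 2 * h) \<le> f x" "f x \<le> f (x + 2 * h)" "f x + R * \<bar>h\<bar> \<le> f (x + h)" "g (x + h) \<le> f x - R * \<bar>h\<bar>"
proof -
  have te: "t \<noteq> e" using steep by auto
  have eab: "e \<in> {a..b}" using e t by auto
  have fcc: "(1 - s) * f p + s * f q \<le> f (p + s * (q - p))" if "p \<in> {a..b}" "q \<in> {a..b}" "0 \<le> s" "s \<le> 1" for p q s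
    using concave_onD[OF f that(3,4,1,2)] by (simp add: algebra_simps)
  have gcv: "g (p + s * (q - p)) \<le> (1 - s) * g p + s * g q" if "p \<in> {a..b}" "q \<in> {a..b}" "0 \<le> s" "s \<le> 1" for p q s
    using convex_onD[OF g that(3,4,1,2)] by (simp add: algebra_simps)
  have seg: "p + s * (q - p) \<in> {a..b}" if "p \<in> {a..b}" "q \<in> {a..b}" "0 \<le> s" "s \<le> 1" for p q s
    using convexD_alt[OF convex_real_interval(5) that] by (simp add: algebra_simps)
  \<comment> \<open>Any point \<open>x\<close> between \<open>e\<close> and \<open>t\<close> with \<open>f x < c\<close> can serve as the new start of the chord.\<close>
  define c where "c = f t - R * \<bar>t - e\<bar>"
  have c: "f e < c" using steep by (simp add: c_def)
  let ?z = "\<lambda>s. e + s * (t - e)"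
  have ev01: "eventually (\<lambda>s. 0 < s \<and> s < k) (at_right 0)" if "k > 0" for k :: real
    using that by (intro eventually_at_rightI[of 0 k]) auto
  \<comment> \<open>Semicontinuity of \<open>f\<close> at \<open>e\<close>: the point \<open>(e, c)\<close> lies above the graph of \<open>g\<close> and outside the closed region, so nearby points at height \<open>c\<close> lie above the graph of \<open>f\<close>.\<close>
  have "eventually (\<lambda>s. 0 < s \<and> s < 1 \<and> f (?z s) < c) (at_right 0)"
  proof -
    have "((\<lambda>s. (?z s, c)) \<longlongrightarrow> (e, c)) (at_right 0)"
      by (auto intro!: tendsto_eq_intros)
    moreover have "(e, c) \<notin> {(x, y). x \<in> {a..b} \<and> g x \<le> y \<and> y \<le> f x}" using c by simp
    ultimately have "eventually (\<lambda>s. (?z s, c) \<in> - {(x, y). x \<in> {a..b} \<and> g x \<le> y \<and> y \<le> f x}) (at_right 0)"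
      using closed by (intro topological_tendstoD[where l = "(e, c)"]) (auto simp: open_Compl)
    moreover have "eventually (\<lambda>s. (1 - s) * g e + s * g t < c) (at_right 0)"
    proof (rule order_tendstoD(2))
      show "((\<lambda>s. (1 - s) * g e + s * g t) \<longlongrightarrow> g e) (at_right 0)"
        by (auto intro!: tendsto_eq_intros)
      show "g e < c" using c e by simp
    qed
    moreover note ev01[of 1, simplified]
    ultimately show ?thesis
    proof eventually_elim
      case (elim s)
      have "?z s \<in> {a..b}" using seg[OF eab t] elim by simp
      moreover have "g (?z s) \<le> c" using gcv[OF eab t, of s] elim by simp
      ultimately show ?case using elim by auto
    qed
  qed
  from eventually_happens'[OF _ this] obtain s where s: "0 < s" "s < 1" "f (?z s) < c" by auto
  define x where "x = ?z s"
  define d where "d = t - x"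
  have d: "d = (1 - s) * (t - e)" by (simp add: d_def x_def algebra_simps)
  have d0: "d \<noteq> 0" using s te by (simp add: d)
  have x: "x \<in> {a..b}" using seg[OF eab t, of s] s by (simp add: x_def)
  have xin: "x \<in> {a<..<b}"
  proof (cases "e < t")
    case True
    then have "e < x" "0 < d" using s by (simp_all add: x_def d)
    then have "e < x" "x < t" by (simp_all add: d_def)
    then show ?thesis using e t eab by auto
  next
    case False
    then have "x < e" "d < 0" using s te by (simp_all add: x_def d mult_pos_neg)
    then have "x < e" "t < x" by (simp_all add: d_def)
    then show ?thesis using e t eab by auto
  qed
  have "\<bar>d\<bar> \<le> \<bar>t - e\<bar>" using s by (simp add: d abs_mult mult_left_le_one_le)
  then have "R * \<bar>d\<bar> \<le> R * \<bar>t - e\<bar>" using \<open>R > 0\<close> by simp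
  then have rise: "R * \<bar>d\<bar> \<le> f t - f x" using s(3) by (simp add: c_def x_def)
  have low: "eventually (\<lambda>k. (1 - r * k) * g x + r * k * g t + R * k * \<bar>d\<bar> < f x) (at_right 0)" for r
  proof (rule order_tendstoD(2))
    show "((\<lambda>k. (1 - r * k) * g x + r * k * g t + R * k * \<bar>d\<bar>) \<longlongrightarrow> g x) (at_right 0)"
      by (auto intro!: tendsto_eq_intros)
  qed (rule strict[OF xin])
  have "eventually (\<lambda>k. (0 < k \<and> k < 1 / 2) \<and> (1 - 1 * k) * g x + 1 * k * g t + R * k * \<bar>d\<bar> < f x
      \<and> (1 - 2 * k) * g x + 2 * k * g t + R * k * \<bar>d\<bar> < f x) (at_right 0)"
    by (intro eventually_conj ev01 low) simp
  from eventually_happens'[OF _ this] obtain k where k: "0 < k" "k < 1 / 2"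
    "(1 - k) * g x + k * g t + R * k * \<bar>d\<bar> < f x"
    "(1 - 2 * k) * g x + 2 * k * g t + R * k * \<bar>d\<bar> < f x" by auto
  have pos: "0 \<le> R * k * \<bar>d\<bar>" using \<open>R > 0\<close> k by simp
  show ?thesis
  proof (rule that[of x "k * d"])
    have 2: "x + 2 * (k * d) = x + (2 * k) * (t - x)" by (simp add: d_def)
    show "x + 2 * (k * d) \<in> {a..b}" "x + k * d \<in> {a..b}"
      using seg[OF x t, of "2 * k"] seg[OF x t, of k] k unfolding 2 by (simp_all add: d_def)
    show "g (x + 2 * (k * d)) \<le> f x"
      using gcv[OF x t, of "2 * k"] k pos unfolding 2 by linarith
    have "(1 - 2 * k) * f x + 2 * k * f t \<le> f (x + 2 * (k * d))"
      using fcc[OF x t, of "2 * k"] k unfolding 2 by linarith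
    moreover have "0 \<le> 2 * k * (f t - f x)"
      using order_trans[OF _ rise, of 0] \<open>R > 0\<close> k by (intro mult_nonneg_nonneg) auto
    ultimately show "f x \<le> f (x + 2 * (k * d))" by (simp add: algebra_simps)
    have "(1 - k) * f x + k * f t \<le> f (x + k * d)"
      using fcc[OF x t, of k] k by (simp add: d_def)
    moreover have "k * (R * \<bar>d\<bar>) \<le> k * (f t - f x)"
      using rise k by (intro mult_left_mono) auto
    ultimately show "f x + R * \<bar>k * d\<bar> \<le> f (x + k * d)"
      using k by (simp add: algebra_simps abs_mult)
    show "g (x + k * d) \<le> f x - R * \<bar>k * d\<bar>"
      using gcv[OF x t, of k] k by (simp add: d_def abs_mult)
  qed (use x d0 k in auto)
qed

locale graph_domain =
  fixes a b :: real and \<phi>\<^sub>1 \<phi>\<^sub>2 :: "real \<Rightarrow> real" and \<Omega> :: "plane set"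
  assumes \<Omega>: "\<Omega> = {(x, y). x \<in> {a..b} \<and> \<phi>\<^sub>1 x \<le> y \<and> y \<le> \<phi>\<^sub>2 x}"
    and dom: "convex_compact_domain \<Omega>"
    and cv: "convex_on {a..b} \<phi>\<^sub>1"
    and cc: "concave_on {a..b} \<phi>\<^sub>2"
    and le: "\<And>x. x \<in> {a..b} \<Longrightarrow> \<phi>\<^sub>1 x \<le> \<phi>\<^sub>2 x"
begin

lemma compact: "compact \<Omega>" and convex: "convex \<Omega>" and interior_nonempty: "interior \<Omega> \<noteq> {}"
  using dom by (auto simp: convex_compact_domain_def)

lemma closed: "closed \<Omega>" using compact by (rule compact_imp_closed)

lemma mem_iff: "(x, y) \<in> \<Omega> \<longleftrightarrow> x \<in> {a..b} \<and> \<phi>\<^sub>1 x \<le> y \<and> y \<le> \<phi>\<^sub>2 x"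
  by (simp add: \<Omega>)

lemma interiorD:
  assumes "(x, y) \<in> interior \<Omega>"
  shows "a < x" "x < b" "\<phi>\<^sub>1 x < y" "y < \<phi>\<^sub>2 x"
proof -
  obtain d where d: "d > 0" "cball (x, y) d \<subseteq> \<Omega>"
    using assms open_contains_cball[of "interior \<Omega>"] interior_subset[of \<Omega>] by blast
  have "(x - d, y) \<in> \<Omega>" "(x + d, y) \<in> \<Omega>" "(x, y - d) \<in> \<Omega>" "(x, y + d) \<in> \<Omega>"
    using d(1) by (auto intro!: subsetD[OF d(2)] simp: dist_Pair_Pair dist_real_def)
  then show "a < x" "x < b" "\<phi>\<^sub>1 x < y" "y < \<phi>\<^sub>2 x" using d(1) by (auto simp: mem_iff)
qed

lemma ab: "a < b"
proof -
  obtain p where "p \<in> interior \<Omega>" using interior_nonempty by blast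
  then show ?thesis using interiorD[of "fst p" "snd p"] by simp
qed

text \<open>All points of the segment from a point over an end of the interval to an interior point are
  interior, except possibly the first one.\<close>

lemma strict:
  assumes x: "x \<in> {a<..<b}"
  shows "\<phi>\<^sub>1 x < \<phi>\<^sub>2 x"
proof -
  obtain x0 y0 where c: "(x0, y0) \<in> interior \<Omega>" using interior_nonempty by fastforce
  note c' = interiorD[OF c]
  define e where "e = (if x \<le> x0 then a else b)"
  have e: "(e, \<phi>\<^sub>1 e) \<in> \<Omega>" using ab le by (auto simp: e_def mem_iff)
  define t where "t = (x - e) / (x0 - e)"
  have t: "0 < t" "t \<le> 1" using x c' by (auto simp: t_def e_def divide_simps)
  have "(e, \<phi>\<^sub>1 e) - t *\<^sub>R ((e, \<phi>\<^sub>1 e) - (x0, y0)) \<in> interior \<Omega>"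
    using mem_interior_convex_shrink[OF convex c e t] .
  moreover have "e - t * (e - x0) = x" using c' by (auto simp: t_def e_def field_simps)
  ultimately have "(x, \<phi>\<^sub>1 e - t * (\<phi>\<^sub>1 e - y0)) \<in> interior \<Omega>" by simp
  from interiorD[OF this] show ?thesis by simp
qed

lemma frontierI:
  assumes "(x, y) \<in> \<Omega>" "x = a \<or> x = b \<or> y = \<phi>\<^sub>1 x \<or> y = \<phi>\<^sub>2 x"
  shows "(x, y) \<in> frontier \<Omega>"
  using assms interiorD[of x y] closure_subset unfolding frontier_def by fastforce

lemma K_inf_ge_if_steep_top:
  assumes e: "e \<in> {a, b}" and t: "t \<in> {a..b}" and R: "R > 0" and steep: "\<phi>\<^sub>2 t - \<phi>\<^sub>2 e > R * \<bar>t - e\<bar>"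
  shows "ereal R \<le> K_inf \<Omega>"
proof -
  have "\<phi>\<^sub>1 e \<le> \<phi>\<^sub>2 e" using e ab le by auto
  obtain x h where *: "x \<in> {a..b}" "h \<noteq> 0" "x + 2 * h \<in> {a..b}" "x + h \<in> {a..b}"
    "\<phi>\<^sub>1 (x + 2 * h) \<le> \<phi>\<^sub>2 x" "\<phi>\<^sub>2 x \<le> \<phi>\<^sub>2 (x + 2 * h)"
    "\<phi>\<^sub>2 x + R * \<bar>h\<bar> \<le> \<phi>\<^sub>2 (x + h)" "\<phi>\<^sub>1 (x + h) \<le> \<phi>\<^sub>2 x - R * \<bar>h\<bar>"
    by (rule inner_diamond_at_graph[OF cc cv closed[unfolded \<Omega>] strict e \<open>\<phi>\<^sub>1 e \<le> \<phi>\<^sub>2 e\<close> t R steep])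
  have "0 < R * \<bar>h\<bar>" using R * by simp
  then show ?thesis
    using * le by (intro K_inf_ge_if_diamond[OF dom R, of x "\<phi>\<^sub>2 x" h] frontierI) (auto simp: mem_iff)
qed

lemma K_inf_ge_if_steep_bottom:
  assumes e: "e \<in> {a, b}" and t: "t \<in> {a..b}" and R: "R > 0" and steep: "\<phi>\<^sub>1 e - \<phi>\<^sub>1 t > R * \<bar>t - e\<bar>"
  shows "ereal R \<le> K_inf \<Omega>"
proof -
  have 1: "concave_on {a..b} (\<lambda>x. - \<phi>\<^sub>1 x)" using cv by (simp add: concave_on_def)
  have 2: "convex_on {a..b} (\<lambda>x. - \<phi>\<^sub>2 x)" using cc by (simp add: concave_on_def)
  have "closed ((\<lambda>p. (fst p, - snd p)) -` \<Omega>)"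
    by (intro closed_vimage closed continuous_intros)
  moreover have "(\<lambda>p. (fst p, - snd p)) -` \<Omega> = {(x, y). x \<in> {a..b} \<and> - \<phi>\<^sub>2 x \<le> y \<and> y \<le> - \<phi>\<^sub>1 x}"
    by (auto simp: mem_iff)
  ultimately have 3: "closed {(x, y). x \<in> {a..b} \<and> - \<phi>\<^sub>2 x \<le> y \<and> y \<le> - \<phi>\<^sub>1 x}" by simp
  have 4: "- \<phi>\<^sub>2 x < - \<phi>\<^sub>1 x" if "x \<in> {a<..<b}" for x using strict[OF that] by simp
  have 5: "- \<phi>\<^sub>2 e \<le> - \<phi>\<^sub>1 e" using e ab le by auto
  have 6: "- \<phi>\<^sub>1 t - - \<phi>\<^sub>1 e > R * \<bar>t - e\<bar>" using steep by simp
  obtain x h where *: "x \<in> {a..b}" "h \<noteq> 0" "x + 2 * h \<in> {a..b}" "x + h \<in> {a..b}"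
    "- \<phi>\<^sub>2 (x + 2 * h) \<le> - \<phi>\<^sub>1 x" "- \<phi>\<^sub>1 x \<le> - \<phi>\<^sub>1 (x + 2 * h)"
    "- \<phi>\<^sub>1 x + R * \<bar>h\<bar> \<le> - \<phi>\<^sub>1 (x + h)" "- \<phi>\<^sub>2 (x + h) \<le> - \<phi>\<^sub>1 x - R * \<bar>h\<bar>"
    by (rule inner_diamond_at_graph[OF 1 2 3 4 e 5 t R 6])
  have "0 < R * \<bar>h\<bar>" using R * by simp
  then show ?thesis
    using * le by (intro K_inf_ge_if_diamond[OF dom R, of x "\<phi>\<^sub>1 x" h] frontierI) (auto simp: mem_iff)
qed

text \<open>The diamond has a vertex at the midpoint of the vertical edge; the chords of the two graphs leave
  room for it when it is small.\<close>

lemma K_inf_ge_if_edge: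
  assumes e: "e \<in> {a, b}" and edge: "\<phi>\<^sub>1 e < \<phi>\<^sub>2 e" and R: "R > 0"
  shows "ereal R \<le> K_inf \<Omega>"
proof -
  define d where "d = (if e = a then b - a else a - b)"
  define y where "y = (\<phi>\<^sub>1 e + \<phi>\<^sub>2 e) / 2"
  have y: "\<phi>\<^sub>1 e < y" "y < \<phi>\<^sub>2 e" using edge by (auto simp: y_def)
  have ends: "e \<in> {a..b}" "e + d \<in> {a..b}" "d \<noteq> 0" using e ab by (auto simp: d_def)
  have up: "eventually (\<lambda>k. y + R * k * \<bar>d\<bar> < (1 - r * k) * \<phi>\<^sub>2 e + r * k * \<phi>\<^sub>2 (e + d)) (at_right 0)" for r
  proof -
    have "((\<lambda>k. (1 - r * k) * \<phi>\<^sub>2 e + r * k * \<phi>\<^sub>2 (e + d) - R * k * \<bar>d\<bar>) \<longlongrightarrow> \<phi>\<^sub>2 e) (at_right 0)"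
      by (auto intro!: tendsto_eq_intros)
    from order_tendstoD(1)[OF this y(2)] show ?thesis by eventually_elim simp
  qed
  have down: "eventually (\<lambda>k. (1 - r * k) * \<phi>\<^sub>1 e + r * k * \<phi>\<^sub>1 (e + d) < y - R * k * \<bar>d\<bar>) (at_right 0)" for r
  proof -
    have "((\<lambda>k. (1 - r * k) * \<phi>\<^sub>1 e + r * k * \<phi>\<^sub>1 (e + d) + R * k * \<bar>d\<bar>) \<longlongrightarrow> \<phi>\<^sub>1 e) (at_right 0)"
      by (auto intro!: tendsto_eq_intros)
    from order_tendstoD(2)[OF this y(1)] show ?thesis by eventually_elim simp
  qed
  have "eventually (\<lambda>k::real. 0 < k \<and> k < 1 / 2) (at_right 0)"
    by (intro eventually_at_rightI[of 0 "1/2"]) auto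
  with up[of 1] up[of 2] down[of 1] down[of 2]
  have "eventually (\<lambda>k. 0 < k \<and> k < 1 / 2
      \<and> y + R * k * \<bar>d\<bar> < (1 - k) * \<phi>\<^sub>2 e + k * \<phi>\<^sub>2 (e + d)
      \<and> y + R * k * \<bar>d\<bar> < (1 - 2 * k) * \<phi>\<^sub>2 e + 2 * k * \<phi>\<^sub>2 (e + d)
      \<and> (1 - k) * \<phi>\<^sub>1 e + k * \<phi>\<^sub>1 (e + d) < y - R * k * \<bar>d\<bar>
      \<and> (1 - 2 * k) * \<phi>\<^sub>1 e + 2 * k * \<phi>\<^sub>1 (e + d) < y - R * k * \<bar>d\<bar>) (at_right 0)"
    by eventually_elim simp
  from eventually_happens'[OF _ this] obtain k where k: "0 < k" "k < 1 / 2"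
    "y + R * k * \<bar>d\<bar> < (1 - k) * \<phi>\<^sub>2 e + k * \<phi>\<^sub>2 (e + d)"
    "y + R * k * \<bar>d\<bar> < (1 - 2 * k) * \<phi>\<^sub>2 e + 2 * k * \<phi>\<^sub>2 (e + d)"
    "(1 - k) * \<phi>\<^sub>1 e + k * \<phi>\<^sub>1 (e + d) < y - R * k * \<bar>d\<bar>"
    "(1 - 2 * k) * \<phi>\<^sub>1 e + 2 * k * \<phi>\<^sub>1 (e + d) < y - R * k * \<bar>d\<bar>" by auto
  have pos: "0 \<le> R * k * \<bar>d\<bar>" using R k by simp
  have "(1 - s) * \<phi>\<^sub>2 e + s * \<phi>\<^sub>2 (e + d) \<le> \<phi>\<^sub>2 (e + s * d)" "\<phi>\<^sub>1 (e + s * d) \<le> (1 - s) * \<phi>\<^sub>1 e + s * \<phi>\<^sub>1 (e + d)"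
    "e + s * d \<in> {a..b}" if "0 \<le> s" "s \<le> 1" for s
    using concave_onD[OF cc that ends(1,2)] convex_onD[OF cv that ends(1,2)]
      convexD_alt[OF convex_real_interval(5) ends(1,2) that] by (simp_all add: algebra_simps)
  from this[of k] this[of "2 * k"] show ?thesis
    using k pos y e ends
    by (intro K_inf_ge_if_diamond[OF dom R, of e y "k * d"] frontierI) (auto simp: mem_iff abs_mult mult.assoc)
qed

text \<open>With \<open>w\<close> the height of the corner \<open>\<xi> = (e, w)\<close>, concavity on the segment from \<open>p = (x, y)\<close> to
  \<open>\<xi>\<close> and the Lipschitz bound along vertical lines give \<open>u\<^sub>x p \<cdot> (x - e) \<le> u p + M \<bar>w - y\<bar>\<close>. The right-hand
  side is bounded by following the vertical chord through \<open>p\<close> from \<open>w\<close> towards \<open>y\<close> and beyond, to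
  the end where \<open>u\<close> vanishes.\<close>

lemma dir_deriv_x_le:
  assumes u: "u \<in> concave_class \<Omega>" and M: "sup_norm \<Omega> (partial_y u) \<le> ereal M" "0 \<le> M"
    and e: "e \<in> {a, b}" "\<phi>\<^sub>1 e = \<phi>\<^sub>2 e"
    and cone: "\<And>t. t \<in> {a..b} \<Longrightarrow> \<phi>\<^sub>2 t - \<phi>\<^sub>2 e \<le> m * \<bar>t - e\<bar>" "\<And>t. t \<in> {a..b} \<Longrightarrow> \<phi>\<^sub>1 e - \<phi>\<^sub>1 t \<le> m * \<bar>t - e\<bar>"
    and p: "(x, y) \<in> interior \<Omega>" "dir_differentiable (1, 0) u (x, y)"
  shows "dir_deriv (1, 0) u (x, y) * (x - e) \<le> m * M * \<bar>x - e\<bar>"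
proof -
  interpret concave_on_domain \<Omega> u
    using u dom by unfold_locales (auto simp: concave_class_def)
  have zero: "u q = 0" if "q \<in> frontier \<Omega>" for q using u that by (auto simp: concave_class_def)
  have Lip: "u (r, s + d) - u (r, s) \<le> M * \<bar>d\<bar>" if "(r, s) \<in> \<Omega>" "(r, s + d) \<in> \<Omega>" for r s d
    using Lipschitz_along_axis[of "(0, 1)" M "(r, s)" d] M that by (simp add: partial_y_eq)
  define w where "w = \<phi>\<^sub>1 e"
  define B where "B = u (x, y) + M * \<bar>w - y\<bar>"
  have xy: "(x, y) \<in> \<Omega>" using p interior_subset by blast
  note in' = interiorD[OF p(1)]
  have xab: "x \<in> {a..b}" using in' by auto
  have ew: "(e, w) \<in> \<Omega>" "(e, w) \<in> frontier \<Omega>"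
    using e ab by (auto simp: mem_iff w_def intro!: frontierI)
  have b1: "u (x, y) \<le> M * (y - \<phi>\<^sub>1 x)"
    using Lip[of x "\<phi>\<^sub>1 x" "y - \<phi>\<^sub>1 x"] xy xab in' le[OF xab] zero[OF frontierI[of x "\<phi>\<^sub>1 x"]] by (simp add: mem_iff)
  have b2: "u (x, y) \<le> M * (\<phi>\<^sub>2 x - y)"
    using Lip[of x "\<phi>\<^sub>2 x" "y - \<phi>\<^sub>2 x"] xy xab in' le[OF xab] zero[OF frontierI[of x "\<phi>\<^sub>2 x"]] by (simp add: mem_iff)
  have B: "B \<le> m * M * \<bar>x - e\<bar>"
  proof (cases "y \<le> w")
    case True
    then have "B \<le> M * (w - \<phi>\<^sub>1 x)" using b1 by (simp add: B_def algebra_simps)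
    also have "\<dots> \<le> M * (m * \<bar>x - e\<bar>)"
      using cone(2)[OF xab] M by (intro mult_left_mono) (auto simp: w_def)
    finally show ?thesis by (simp add: ac_simps)
  next
    case False
    then have "B \<le> M * (\<phi>\<^sub>2 x - w)" using b2 by (simp add: B_def algebra_simps)
    also have "\<dots> \<le> M * (m * \<bar>x - e\<bar>)"
      using cone(1)[OF xab] M e by (intro mult_left_mono) (auto simp: w_def)
    finally show ?thesis by (simp add: ac_simps)
  qed
  have "eventually (\<lambda>t. (x, y) + (t * (e - x)) *\<^sub>R (1, 0) \<in> interior \<Omega>) (at_right 0)"
  proof (rule topological_tendstoD[OF _ open_interior p(1)])
    show "((\<lambda>t. (x, y) + (t * (e - x)) *\<^sub>R (1, 0)) \<longlongrightarrow> (x, y)) (at_right 0)"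
      by (auto intro!: tendsto_eq_intros simp: zero_prod_def)
  qed
  moreover have "eventually (\<lambda>t::real. 0 < t \<and> t < 1) (at_right 0)"
    by (intro eventually_at_rightI[of 0 1]) auto
  ultimately have "eventually (\<lambda>t. (x, y) + (t * (e - x)) *\<^sub>R (1, 0) \<in> interior \<Omega> \<and> 0 < t \<and> t < 1) (at_right 0)"
    by (rule eventually_conj)
  from eventually_happens'[OF _ this] obtain t
    where t: "(x, y) + (t * (e - x)) *\<^sub>R (1, 0) \<in> interior \<Omega>" "0 < t" "t < 1" by auto
  let ?r = "x + t * (e - x)"
  have r: "(?r, y) \<in> \<Omega>" using t(1) interior_subset by auto
  have Q: "(1 - t) *\<^sub>R (x, y) + t *\<^sub>R (e, w) = (?r, y + t * (w - y))" by (simp add: algebra_simps)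
  have "(1 - t) * u (x, y) + t * u (e, w) \<le> u (?r, y + t * (w - y))"
    using concave_onD[OF conc _ _ xy ew(1), of t] t unfolding Q by simp
  moreover have "u (?r, y + t * (w - y)) - u (?r, y) \<le> M * \<bar>t * (w - y)\<bar>"
    using convexD_alt[OF convex xy ew(1), of t] t r unfolding Q by (intro Lip) auto
  moreover have "u (?r, y) - u (x, y) \<le> dir_deriv (1, 0) u (x, y) * (t * (e - x))"
    using tangent_above[OF p(2,1) t(1)] by simp
  moreover have "\<bar>t * (w - y)\<bar> = t * \<bar>w - y\<bar>" using t by (simp add: abs_mult)
  ultimately have "t * (dir_deriv (1, 0) u (x, y) * (x - e)) \<le> t * B"
    using zero[OF ew(2)] by (simp add: B_def algebra_simps)
  then show ?thesis using B t by simp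
qed

text \<open>The corners at \<open>a\<close> and \<open>b\<close> bound the horizontal derivative from above and from below,
  respectively.\<close>

lemma K_inf_le:
  assumes corners: "\<phi>\<^sub>1 a = \<phi>\<^sub>2 a" "\<phi>\<^sub>1 b = \<phi>\<^sub>2 b"
    and top: "\<And>e t. e \<in> {a, b} \<Longrightarrow> t \<in> {a..b} \<Longrightarrow> \<phi>\<^sub>2 t - \<phi>\<^sub>2 e \<le> m * \<bar>t - e\<bar>"
    and bottom: "\<And>e t. e \<in> {a, b} \<Longrightarrow> t \<in> {a..b} \<Longrightarrow> \<phi>\<^sub>1 e - \<phi>\<^sub>1 t \<le> m * \<bar>t - e\<bar>"
  shows "K_inf \<Omega> \<le> ereal m"
  unfolding K_inf_def
proof (rule SUP_least)
  fix u assume "u \<in> {u \<in> concave_class \<Omega>. \<exists>p\<in>\<Omega>. u p \<noteq> 0}"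
  then obtain x y where u: "u \<in> concave_class \<Omega>" and p: "(x, y) \<in> \<Omega>" "u (x, y) \<noteq> 0" by auto
  interpret concave_on_domain \<Omega> u
    using u dom by unfold_locales (auto simp: concave_class_def)
  obtain C where C: "\<And>p. p \<in> interior \<Omega> \<Longrightarrow> has_gradient u p \<Longrightarrow> norm (partial_x u p, partial_y u p) \<le> C"
    using u by (auto simp: concave_class_def)
  have "sup_norm \<Omega> (partial_y u) \<le> ereal C"
    unfolding partial_y_eq
  proof (rule sup_norm_le)
    fix p assume "p \<in> interior \<Omega>" "dir_differentiable (1, 0) u p" "dir_differentiable (0, 1) u p"
    then show "\<bar>dir_deriv (0, 1) u p\<bar> \<le> C"
      using C[of p] norm_snd_le[of "partial_y u p" "partial_x u p"] by (simp add: has_gradient_iff partial_y_eq)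
  qed simp
  then obtain M where M: "sup_norm \<Omega> (partial_y u) = ereal M"
    using sup_norm_nonneg[of "partial_y u"] by (cases "sup_norm \<Omega> (partial_y u)") auto
  have M0: "0 \<le> M" using sup_norm_nonneg[of "partial_y u"] M by simp
  \<comment> \<open>Otherwise \<open>u\<close> would be constant on vertical chords and thus zero, so the quotient is a genuine one.\<close>
  have "M \<noteq> 0"
  proof
    assume "M = 0"
    have xab: "x \<in> {a..b}" using p by (simp add: mem_iff)
    have f: "(x, \<phi>\<^sub>1 x) \<in> \<Omega>" using le[OF xab] xab by (simp add: mem_iff)
    have "u (x, y) - u (x, \<phi>\<^sub>1 x) \<le> 0"
      using Lipschitz_along_axis[of "(0, 1)" M "(x, \<phi>\<^sub>1 x)" "y - \<phi>\<^sub>1 x"] M p f \<open>M = 0\<close> by (simp add: partial_y_eq)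
    moreover have "u (x, \<phi>\<^sub>1 x) - u (x, y) \<le> 0"
      using Lipschitz_along_axis[of "(0, 1)" M "(x, y)" "\<phi>\<^sub>1 x - y"] M p f \<open>M = 0\<close> by (simp add: partial_y_eq)
    moreover have "u (x, \<phi>\<^sub>1 x) = 0" using u frontierI[OF f] by (auto simp: concave_class_def)
    ultimately show False using p by simp
  qed
  then have "M > 0" using M0 by simp
  have "sup_norm \<Omega> (partial_x u) \<le> ereal (m * M)"
    unfolding partial_x_eq
  proof (rule sup_norm_le)
    fix p assume p: "p \<in> interior \<Omega>" and D: "dir_differentiable (1, 0) u p"
    obtain x y where xy: "p = (x, y)" by fastforce
    have "dir_deriv (1, 0) u (x, y) * (x - a) \<le> m * M * \<bar>x - a\<bar>"
      using corners p D xy M M0 top[of a] bottom[of a] by (intro dir_deriv_x_le[OF u]) auto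
    moreover have "dir_deriv (1, 0) u (x, y) * (x - b) \<le> m * M * \<bar>x - b\<bar>"
      using corners p D xy M M0 top[of b] bottom[of b] by (intro dir_deriv_x_le[OF u]) auto
    ultimately have "dir_deriv (1, 0) u (x, y) * (x - a) \<le> (m * M) * (x - a)"
      "(- dir_deriv (1, 0) u (x, y)) * (b - x) \<le> (m * M) * (b - x)"
      using interiorD[of x y] p xy by (auto simp: algebra_simps)
    moreover have "0 < x - a" "0 < b - x" using interiorD[of x y] p xy by auto
    ultimately have "dir_deriv (1, 0) u (x, y) \<le> m * M" "- dir_deriv (1, 0) u (x, y) \<le> m * M"
      using mult_right_le_imp_le by blast+
    then show "\<bar>dir_deriv (1, 0) u p\<bar> \<le> m * M" by (simp add: xy abs_le_iff)
  qed simp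
  then show "sup_norm \<Omega> (partial_x u) / sup_norm \<Omega> (partial_y u) \<le> ereal m"
    using \<open>M > 0\<close> unfolding M by (subst ereal_divide_le_pos) (auto simp: mult.commute)
qed

end

section \<open>Slopes at the end points and angular support lines\<close>

text \<open>The slopes of a concave function decrease, so the steepest rise is at the left end and the
  steepest fall at the right end. The premise bounds exactly these two.\<close>

lemma concave_slopes_le:
  fixes f :: "real \<Rightarrow> real"
  assumes f: "concave_on {a..b} f"
    and ends: "\<And>e t. e \<in> {a, b} \<Longrightarrow> t \<in> {a..b} \<Longrightarrow> f t - f e \<le> R * \<bar>t - e\<bar>"
    and x: "x \<in> {a..b}" and t: "t \<in> {a..b}" and "x \<noteq> t"
  shows "\<bar>(f t - f x) / (t - x)\<bar> \<le> R"
proof -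
  have f': "convex_on {a..b} (\<lambda>x. - f x)" using f by (simp add: concave_on_def)
  have main: "\<bar>(f t - f x) / (t - x)\<bar> \<le> R" if "x \<in> {a..b}" "t \<in> {a..b}" "x < t" for x t
  proof -
    have xt: "(f x - f t) / (x - t) = (f t - f x) / (t - x)"
      by (metis minus_diff_eq minus_divide_divide)
    have "(f t - f x) / (t - x) \<le> R"
    proof (cases "x = a")
      case True
      then show ?thesis using ends[of a t] that by (simp add: divide_le_eq)
    next
      case False
      have "(- f a - - f x) / (a - x) \<le> (- f t - - f x) / (t - x)"
        using False that by (intro convex_slope_mono[OF f']) auto
      moreover have "(f x - f a) / (x - a) \<le> R"
        using ends[of a x] that False by (simp add: divide_le_eq)
      moreover have "(f x - f a) / (x - a) = - ((- f a - - f x) / (a - x))"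
        by (metis (no_types, opaque_lifting) diff_minus_eq_add minus_diff_eq minus_divide_right uminus_add_conv_diff)
      moreover have "(- f t - - f x) / (t - x) = - ((f t - f x) / (t - x))"
        by (simp add: minus_divide_left)
      ultimately show ?thesis by linarith
    qed
    moreover have "- R \<le> (f t - f x) / (t - x)"
    proof (cases "t = b")
      case True
      then show ?thesis using ends[of b x] that by (simp add: le_divide_eq algebra_simps)
    next
      case False
      have "(- f x - - f t) / (x - t) \<le> (- f b - - f t) / (b - t)"
        using False that by (intro convex_slope_mono[OF f']) auto
      moreover have "- R \<le> (f b - f t) / (b - t)"
        using ends[of b t] that False by (simp add: le_divide_eq algebra_simps)
      moreover have "(- f x - - f t) / (x - t) = - ((f t - f x) / (t - x))"
        unfolding xt[symmetric] by (simp add: minus_divide_left)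
      moreover have "(- f b - - f t) / (b - t) = - ((f b - f t) / (b - t))"
        by (simp add: minus_divide_left)
      ultimately show ?thesis by linarith
    qed
    ultimately show ?thesis by (intro abs_leI) linarith+
  qed
  show ?thesis
  proof (cases "x < t")
    case False
    then have "t < x" using \<open>x \<noteq> t\<close> by simp
    then show ?thesis using main[OF t x] minus_divide_divide[of "f t - f x" "t - x"] by (simp del: abs_divide)
  qed (use main x t in blast)
qed

lemma abs_le_ereal_iff: "\<bar>d\<bar> \<le> ereal R \<longleftrightarrow> d \<le> ereal R \<and> ereal (- R) \<le> d"
  by (cases d) auto

lemma one_sided_derivs_le:
  assumes f: "concave_on {a..b} f"
    and ends: "\<And>e t. e \<in> {a, b} \<Longrightarrow> t \<in> {a..b} \<Longrightarrow> f t - f e \<le> R * \<bar>t - e\<bar>"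
    and d: "d \<in> one_sided_derivs a b f"
  shows "\<bar>d\<bar> \<le> ereal R"
proof -
  have bound: "\<bar>d\<bar> \<le> ereal R"
    if lim: "((\<lambda>t. ereal ((f t - f x) / (t - x))) \<longlongrightarrow> d) F" and "F \<noteq> bot"
      and ev: "eventually (\<lambda>t. t \<in> {a..b} \<and> t \<noteq> x) F" and "x \<in> {a..b}" for x F
  proof -
    have "eventually (\<lambda>t. \<bar>(f t - f x) / (t - x)\<bar> \<le> R) F"
      using ev by eventually_elim (rule concave_slopes_le[OF f ends], use that in auto)
    then have "eventually (\<lambda>t. ereal ((f t - f x) / (t - x)) \<le> ereal R) F"
      "eventually (\<lambda>t. ereal (- R) \<le> ereal ((f t - f x) / (t - x))) F"
      by (auto elim!: eventually_mono simp: abs_le_iff simp del: abs_divide)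
    then show ?thesis
      unfolding abs_le_ereal_iff using tendsto_upperbound[OF lim] tendsto_lowerbound[OF lim] \<open>F \<noteq> bot\<close> by blast
  qed
  show ?thesis
    using d unfolding one_sided_derivs_def
  proof (elim UnE CollectE bexE)
    fix x assume x: "x \<in> {a..<b}" "((\<lambda>t. ereal ((f t - f x) / (t - x))) \<longlongrightarrow> d) (at_right x)"
    have "eventually (\<lambda>t. t \<in> {a..b} \<and> t \<noteq> x) (at_right x)"
      using x by (intro eventually_at_rightI[of x b]) auto
    then show ?thesis using bound[OF x(2)] x by auto
  next
    fix x assume x: "x \<in> {a<..b}" "((\<lambda>t. ereal ((f t - f x) / (t - x))) \<longlongrightarrow> d) (at_left x)"
    have "eventually (\<lambda>t. t \<in> {a..b} \<and> t \<noteq> x) (at_left x)"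
      using x by (intro eventually_at_leftI[of a x]) auto
    then show ?thesis using bound[OF x(2)] x by auto
  qed
qed

lemma one_sided_derivs_uminus:
  assumes "d \<in> one_sided_derivs a b f"
  shows "- d \<in> one_sided_derivs a b (\<lambda>x. - f x)"
proof -
  have "((\<lambda>t. ereal ((- f t - - f x) / (t - x))) \<longlongrightarrow> - d) F"
    if "((\<lambda>t. ereal ((f t - f x) / (t - x))) \<longlongrightarrow> d) F" for x F
  proof -
    have "(- f t - - f x) / (t - x) = - ((f t - f x) / (t - x))" for t
      by (simp add: minus_divide_left)
    then show ?thesis using tendsto_uminus_ereal[OF that] by simp
  qed
  then show ?thesis using assms unfolding one_sided_derivs_def by blast
qed

text \<open>The converse direction: chords from an end point are no steeper than the one-sided derivative
  there. The bound \<open>S\<close> ensures that this derivative exists and is finite.\<close>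

lemma end_slopes_le:
  assumes f: "concave_on {a..b} f" and "a < b"
    and ends: "\<And>e t. e \<in> {a, b} \<Longrightarrow> t \<in> {a..b} \<Longrightarrow> f t - f e \<le> S * \<bar>t - e\<bar>"
    and m: "\<And>d. d \<in> one_sided_derivs a b f \<Longrightarrow> \<bar>d\<bar> \<le> ereal m"
    and e: "e \<in> {a, b}" and t: "t \<in> {a..b}"
  shows "f t - f e \<le> m * \<bar>t - e\<bar>"
proof (cases "t = e")
  case False
  let ?g = "\<lambda>x. - f x"
  have g: "convex_on {a..b} ?g" using f by (simp add: concave_on_def)
  have slopes: "\<bar>(?g s - ?g e) / (s - e)\<bar> \<le> S" if "s \<in> {a..b}" "s \<noteq> e" for s
  proof -
    have "(?g s - ?g e) / (s - e) = - ((f s - f e) / (s - e))" by (simp add: minus_divide_left)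
    then show ?thesis
      using concave_slopes_le[OF f ends, of e s] that e \<open>a < b\<close> by auto
  qed
  have mem: "\<bar>ereal d\<bar> \<le> ereal m"
    if "((\<lambda>t. (?g t - ?g e) / (t - e)) \<longlongrightarrow> d) F" "F = at_right e \<and> e = a \<or> F = at_left e \<and> e = b" for d F
  proof -
    have "(- ?g s - - ?g e) / (s - e) = - ((?g s - ?g e) / (s - e))" for s
      by (simp add: minus_divide_left)
    then have "((\<lambda>s. (f s - f e) / (s - e)) \<longlongrightarrow> - d) F"
      using tendsto_minus[OF that(1)] by simp
    then have "ereal (- d) \<in> one_sided_derivs a b f"
      using that(2) \<open>a < b\<close> unfolding one_sided_derivs_def by (auto intro!: tendsto_ereal)
    then show ?thesis using m by force
  qed
  consider "e = a" "a < t" | "e = b" "t < b" using e t False by force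
  then show ?thesis
  proof cases
    case 1
    have lower: "- S \<le> (?g s - ?g a) / (s - a)" if "s \<in> {a..b}" "a < s" for s
      using slopes[of s] that 1 abs_le_D2[of "(?g s - ?g a) / (s - a)" S] by (simp del: abs_divide)
    have a: "a \<in> {a..b}" "open {..<b}" "a \<in> {..<b}" "{..<b} \<inter> {a<..} \<subseteq> {a..b}" using \<open>a < b\<close> by auto
    obtain d where d: "((\<lambda>s. (?g s - ?g a) / (s - a)) \<longlongrightarrow> d) (at_right a)"
      "\<And>s. s \<in> {a..b} \<Longrightarrow> a < s \<Longrightarrow> d \<le> (?g s - ?g a) / (s - a)"
      using convex_right_derivative[OF g a lower] by blast
    have "- m \<le> d" using mem[of d "at_right a"] d(1) 1 by auto
    then have "- m \<le> (?g t - ?g a) / (t - a)" using d(2)[of t] t 1 by simp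
    then show ?thesis using 1 by (simp add: le_divide_eq)
  next
    case 2
    have upper: "(?g s - ?g b) / (s - b) \<le> S" if "s \<in> {a..b}" "s < b" for s
      using slopes[of s] that 2 abs_le_D1[of "(?g s - ?g b) / (s - b)" S] by (simp del: abs_divide)
    have b: "b \<in> {a..b}" "open {a<..}" "b \<in> {a<..}" "{a<..} \<inter> {..<b} \<subseteq> {a..b}" using \<open>a < b\<close> by auto
    obtain d where d: "((\<lambda>s. (?g s - ?g b) / (s - b)) \<longlongrightarrow> d) (at_left b)"
      "\<And>s. s \<in> {a..b} \<Longrightarrow> s < b \<Longrightarrow> (?g s - ?g b) / (s - b) \<le> d"
      using convex_left_derivative[OF g b upper] by blast
    have "d \<le> m" using mem[of d "at_left b"] d(1) 2 by auto
    then have "(?g t - ?g b) / (t - b) \<le> m" using d(2)[of t] t 2 by simp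
    then show ?thesis using 2 by (simp add: divide_le_eq algebra_simps)
  qed
qed simp

context graph_domain
begin

lemma vertical_support_line_iff:
  "support_line \<Omega> L \<and> vertical_line L \<longleftrightarrow> (\<exists>e\<in>{a, b}. L = {p. fst p = e})"
proof
  assume "support_line \<Omega> L \<and> vertical_line L"
  then have "support_line \<Omega> L" "vertical_line L" by auto
  obtain n c where n: "n \<noteq> 0" "L = line n c" "\<Omega> \<subseteq> half_plane n c" "L \<inter> \<Omega> \<noteq> {}"
    using \<open>support_line \<Omega> L\<close> unfolding support_line_def by blast
  obtain e where L: "L = {p. fst p = e}"
    using \<open>vertical_line L\<close> unfolding vertical_line_def by blast
  obtain n1 n2 where n12: "n = (n1, n2)" by fastforce
  have "(e, 0) \<in> L" "(e, 1) \<in> L" by (simp_all add: L)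
  then have "(e, 0) \<in> line n c" "(e, 1) \<in> line n c" unfolding n(2) .
  then have n2: "n2 = 0" "n1 * e = c" by (auto simp: line_def n12)
  have n1: "n1 \<noteq> 0" using n(1) n2 by (auto simp: n12 zero_prod_def)
  obtain y where "(e, y) \<in> \<Omega>" using n(4) unfolding L by auto
  then have eab: "e \<in> {a..b}" by (simp add: mem_iff)
  have "(a, \<phi>\<^sub>1 a) \<in> half_plane n c" "(b, \<phi>\<^sub>1 b) \<in> half_plane n c"
    using n(3) ab le by (auto simp: mem_iff)
  then have "n1 * a \<le> n1 * e" "n1 * b \<le> n1 * e"
    using n2 by (auto simp: half_plane_def n12)
  then have "e = a \<or> e = b" using n1 eab by (cases "n1 > 0") (auto simp: mult_le_cancel_left)
  then show "\<exists>e\<in>{a, b}. L = {p. fst p = e}" using L by auto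
next
  assume "\<exists>e\<in>{a, b}. L = {p. fst p = e}"
  then obtain e where e: "e \<in> {a, b}" "L = {p. fst p = e}" by blast
  define \<sigma> :: real where "\<sigma> = (if e = a then -1 else 1)"
  have "support_line \<Omega> L"
    unfolding support_line_def
  proof (intro exI[of _ "(\<sigma>, 0)"] exI[of _ "\<sigma> * e"] conjI)
    show "L = line (\<sigma>, 0) (\<sigma> * e)" by (auto simp: e line_def \<sigma>_def)
    show "\<Omega> \<subseteq> half_plane (\<sigma>, 0) (\<sigma> * e)" using e ab by (auto simp: half_plane_def \<Omega> \<sigma>_def)
    have "(e, \<phi>\<^sub>1 e) \<in> L \<inter> \<Omega>" using e ab le by (auto simp: mem_iff)
    then show "L \<inter> \<Omega> \<noteq> {}" by blast
  qed (simp add: \<sigma>_def zero_prod_def)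
  then show "support_line \<Omega> L \<and> vertical_line L" using e by (auto simp: vertical_line_def)
qed

text \<open>If the line is angular, then \<open>\<Omega>\<close> meets it only in the singular point \<open>\<xi>\<close>, and the points of the
  line just above and just below \<open>\<xi>\<close> are cut off by support lines through \<open>\<xi>\<close>. These are not
  vertical, and their slopes bound the chords. Conversely, the lines through \<open>\<xi>\<close> with slopes
  \<open>\<plusminus>S\<close> are support lines, and the half-planes that they bound meet the vertical line only in \<open>\<xi>\<close>.\<close>

lemma angular_iff_corner:
  assumes e: "e \<in> {a, b}"
  shows "angular_support_line \<Omega> {p. fst p = e} \<longleftrightarrow> \<phi>\<^sub>1 e = \<phi>\<^sub>2 e \<and>
    (\<exists>S\<ge>0. \<forall>t\<in>{a..b}. \<phi>\<^sub>2 t - \<phi>\<^sub>2 e \<le> S * \<bar>t - e\<bar> \<and> \<phi>\<^sub>1 e - \<phi>\<^sub>1 t \<le> S * \<bar>t - e\<bar>)"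
    (is "angular_support_line \<Omega> ?L \<longleftrightarrow> ?R")
proof
  have eab: "e \<in> {a..b}" using e ab by auto
  assume "angular_support_line \<Omega> ?L"
  then obtain \<xi> where \<xi>: "singular_point \<Omega> \<xi>" "?L \<inter> tangent_cone \<Omega> \<xi> = {\<xi>}"
    by (auto simp: angular_support_line_def)
  have sub: "\<Omega> \<subseteq> tangent_cone \<Omega> \<xi>" by (auto simp: tangent_cone_def)
  define y where "y = \<phi>\<^sub>1 e"
  have "(e, \<phi>\<^sub>1 e) \<in> ?L \<inter> tangent_cone \<Omega> \<xi>" "(e, \<phi>\<^sub>2 e) \<in> ?L \<inter> tangent_cone \<Omega> \<xi>"
    using sub eab le[OF eab] by (auto simp: mem_iff)
  then have eq: "\<xi> = (e, y)" "\<phi>\<^sub>1 e = y" "\<phi>\<^sub>2 e = y" unfolding \<xi>(2) by (auto simp: y_def)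
  \<comment> \<open>The two sides of \<open>\<xi>\<close> on the vertical line: above for \<open>\<sigma> = 1\<close>, below for \<open>\<sigma> = -1\<close>.\<close>
  have side: "\<exists>S\<ge>0. \<forall>t z. (t, z) \<in> \<Omega> \<longrightarrow> \<sigma> * (z - y) \<le> S * \<bar>t - e\<bar>"
    if \<sigma>: "\<sigma> = 1 \<or> \<sigma> = -1" for \<sigma>
  proof -
    have "(e, y + \<sigma>) \<notin> tangent_cone \<Omega> \<xi>"
    proof
      assume "(e, y + \<sigma>) \<in> tangent_cone \<Omega> \<xi>"
      then have "(e, y + \<sigma>) \<in> ?L \<inter> tangent_cone \<Omega> \<xi>" by simp
      then show False unfolding \<xi>(2) using eq(1) \<sigma> by auto
    qed
    then obtain n c where n: "\<Omega> \<subseteq> half_plane n c" "\<xi> \<in> line n c" "(e, y + \<sigma>) \<notin> half_plane n c"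
      by (auto simp: tangent_cone_def)
    obtain n1 n2 where n12: "n = (n1, n2)" by fastforce
    have c: "c = n1 * e + n2 * y" using n(2) by (simp add: line_def n12 eq)
    have pos: "\<sigma> * n2 > 0" using n(3) by (simp add: half_plane_def n12 c algebra_simps)
    have "\<sigma> * (z - y) \<le> \<bar>n1\<bar> / \<bar>n2\<bar> * \<bar>t - e\<bar>" if "(t, z) \<in> \<Omega>" for t z
    proof -
      have "n1 * t + n2 * z \<le> c" using n(1) that by (auto simp: half_plane_def n12)
      then have "n2 * (z - y) \<le> - (n1 * (t - e))" by (simp add: c algebra_simps)
      also have "\<dots> \<le> \<bar>n1\<bar> * \<bar>t - e\<bar>" by (metis abs_ge_minus_self abs_mult)
      also have "n2 * (z - y) = \<bar>n2\<bar> * (\<sigma> * (z - y))" using \<sigma> pos by auto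
      finally have "\<sigma> * (z - y) * \<bar>n2\<bar> \<le> \<bar>n1\<bar> * \<bar>t - e\<bar>" by (simp only: mult.commute)
      moreover have "\<bar>n2\<bar> > 0" using pos by auto
      ultimately show ?thesis by (simp only: times_divide_eq_left pos_le_divide_eq)
    qed
    then show ?thesis by (intro exI[of _ "\<bar>n1\<bar> / \<bar>n2\<bar>"]) auto
  qed
  obtain S1 where S1: "S1 \<ge> 0" "\<And>t z. (t, z) \<in> \<Omega> \<Longrightarrow> 1 * (z - y) \<le> S1 * \<bar>t - e\<bar>" using side[of 1] by auto
  obtain S2 where S2: "S2 \<ge> 0" "\<And>t z. (t, z) \<in> \<Omega> \<Longrightarrow> -1 * (z - y) \<le> S2 * \<bar>t - e\<bar>" using side[of "-1"] by auto
  have "\<phi>\<^sub>2 t - \<phi>\<^sub>2 e \<le> (S1 + S2) * \<bar>t - e\<bar> \<and> \<phi>\<^sub>1 e - \<phi>\<^sub>1 t \<le> (S1 + S2) * \<bar>t - e\<bar>" if "t \<in> {a..b}" for t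
  proof -
    have "(t, \<phi>\<^sub>2 t) \<in> \<Omega>" "(t, \<phi>\<^sub>1 t) \<in> \<Omega>" using that le by (auto simp: mem_iff)
    from S1(2)[OF this(1)] S2(2)[OF this(2)]
    have "\<phi>\<^sub>2 t - \<phi>\<^sub>2 e \<le> S1 * \<bar>t - e\<bar>" "\<phi>\<^sub>1 e - \<phi>\<^sub>1 t \<le> S2 * \<bar>t - e\<bar>" by (simp_all add: eq)
    moreover have "0 \<le> S1 * \<bar>t - e\<bar>" "0 \<le> S2 * \<bar>t - e\<bar>" using S1(1) S2(1) by auto
    ultimately show ?thesis by (simp add: distrib_right)
  qed
  then show ?R using eq S1(1) S2(1) by (intro conjI exI[of _ "S1 + S2"]) auto
next
  have eab: "e \<in> {a..b}" using e ab by auto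
  assume ?R
  then obtain S where corner: "\<phi>\<^sub>1 e = \<phi>\<^sub>2 e" and S: "\<And>t. t \<in> {a..b} \<Longrightarrow> \<phi>\<^sub>2 t - \<phi>\<^sub>2 e \<le> S * \<bar>t - e\<bar>"
    "\<And>t. t \<in> {a..b} \<Longrightarrow> \<phi>\<^sub>1 e - \<phi>\<^sub>1 t \<le> S * \<bar>t - e\<bar>" by blast
  define y where "y = \<phi>\<^sub>1 e"
  define \<sigma> :: real where "\<sigma> = (if e = a then 1 else -1)"
  have abs: "\<bar>t - e\<bar> = \<sigma> * (t - e)" if "t \<in> {a..b}" for t using e that ab by (auto simp: \<sigma>_def)
  have \<xi>: "(e, y) \<in> \<Omega>" "(e, y) \<in> frontier \<Omega>"
    using eab corner e by (auto simp: mem_iff y_def intro!: frontierI)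
  \<comment> \<open>The support lines through \<open>\<xi>\<close> that bound \<open>\<Omega>\<close> from above (\<open>\<tau> = 1\<close>) and from below (\<open>\<tau> = -1\<close>).\<close>
  have n: "(- S * \<sigma>, \<tau>) \<noteq> 0 \<and> \<Omega> \<subseteq> half_plane (- S * \<sigma>, \<tau>) (- S * \<sigma> * e + \<tau> * y) \<and>
      support_line \<Omega> (line (- S * \<sigma>, \<tau>) (- S * \<sigma> * e + \<tau> * y)) \<and> (e, y) \<in> line (- S * \<sigma>, \<tau>) (- S * \<sigma> * e + \<tau> * y)"
    if \<tau>: "\<tau> = 1 \<or> \<tau> = -1" for \<tau>
  proof -
    have 0: "(- S * \<sigma>, \<tau>) \<noteq> 0" using \<tau> by (auto simp: zero_prod_def)
    have "- S * \<sigma> * t + \<tau> * z \<le> - S * \<sigma> * e + \<tau> * y" if "(t, z) \<in> \<Omega>" for t z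
    proof -
      have t: "t \<in> {a..b}" using that by (simp add: mem_iff)
      then have "\<tau> * (z - y) \<le> S * \<bar>t - e\<bar>"
        using S[OF t] that corner \<tau> by (auto simp: mem_iff y_def)
      then show ?thesis unfolding abs[OF t] by (simp add: algebra_simps)
    qed
    then have 1: "\<Omega> \<subseteq> half_plane (- S * \<sigma>, \<tau>) (- S * \<sigma> * e + \<tau> * y)"
      by (auto simp: half_plane_def)
    have 2: "(e, y) \<in> line (- S * \<sigma>, \<tau>) (- S * \<sigma> * e + \<tau> * y)" by (simp add: line_def)
    show ?thesis using 0 1 2 \<xi>(1) unfolding support_line_def by blast
  qed
  have L: "support_line \<Omega> ?L" using vertical_support_line_iff e by blast
  have "singular_point \<Omega> (e, y)"
    unfolding singular_point_def
  proof (intro conjI exI)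
    have "(e, y + 1) \<notin> line (- S * \<sigma>, 1) (- S * \<sigma> * e + 1 * y)" "(e, y + 1) \<in> ?L"
      by (simp_all add: line_def)
    then show "?L \<noteq> line (- S * \<sigma>, 1) (- S * \<sigma> * e + 1 * y)" by metis
  qed (use \<xi> L n[of 1] in auto)
  moreover have "?L \<inter> tangent_cone \<Omega> (e, y) = {(e, y)}"
  proof (intro equalityI subsetI)
    fix p assume p: "p \<in> ?L \<inter> tangent_cone \<Omega> (e, y)"
    then obtain z where z: "p = (e, z)" by (cases p) auto
    have "p \<in> half_plane (- S * \<sigma>, \<tau>) (- S * \<sigma> * e + \<tau> * y)" if "\<tau> = 1 \<or> \<tau> = -1" for \<tau>
      using p n[OF that] unfolding tangent_cone_def by blast
    from this[of 1] this[of "-1"] have "z = y" by (simp add: half_plane_def z)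
    then show "p \<in> {(e, y)}" by (simp add: z)
  next
    fix p assume "p \<in> {(e, y)}"
    then show "p \<in> ?L \<inter> tangent_cone \<Omega> (e, y)" using \<xi> by (auto simp: tangent_cone_def)
  qed
  moreover have "is_line ?L" using L unfolding support_line_def is_line_def by blast
  ultimately show "angular_support_line \<Omega> ?L" unfolding angular_support_line_def by blast
qed

text \<open>The same reduction to chords from the end points serves both inequalities: they are bounded by
  \<open>max_slope\<close>, which is the hypothesis of the upper bound; and if all of them are bounded by \<open>R\<close>, so
  are all one-sided derivatives, so \<open>R < max_slope\<close> forces a chord that is steep enough for the lower
  bound.\<close>

lemma K_inf_eq_max_slope:
  assumes corners: "\<phi>\<^sub>1 a = \<phi>\<^sub>2 a" "\<phi>\<^sub>1 b = \<phi>\<^sub>2 b"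
    and top: "\<And>e t. e \<in> {a, b} \<Longrightarrow> t \<in> {a..b} \<Longrightarrow> \<phi>\<^sub>2 t - \<phi>\<^sub>2 e \<le> S * \<bar>t - e\<bar>"
    and bottom: "\<And>e t. e \<in> {a, b} \<Longrightarrow> t \<in> {a..b} \<Longrightarrow> \<phi>\<^sub>1 e - \<phi>\<^sub>1 t \<le> S * \<bar>t - e\<bar>"
  shows "K_inf \<Omega> = max_slope a b \<phi>\<^sub>1 \<phi>\<^sub>2" "max_slope a b \<phi>\<^sub>1 \<phi>\<^sub>2 < \<infinity>"
proof -
  let ?m = "max_slope a b \<phi>\<^sub>1 \<phi>\<^sub>2"
  have cc1: "concave_on {a..b} (\<lambda>x. - \<phi>\<^sub>1 x)" using cv by (simp add: concave_on_def)
  have derivs_le: "\<bar>d\<bar> \<le> ereal R"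
    if "d \<in> one_sided_derivs a b \<phi>\<^sub>1 \<union> one_sided_derivs a b \<phi>\<^sub>2"
      and R: "\<And>e t. e \<in> {a, b} \<Longrightarrow> t \<in> {a..b} \<Longrightarrow> \<phi>\<^sub>2 t - \<phi>\<^sub>2 e \<le> R * \<bar>t - e\<bar>"
        "\<And>e t. e \<in> {a, b} \<Longrightarrow> t \<in> {a..b} \<Longrightarrow> \<phi>\<^sub>1 e - \<phi>\<^sub>1 t \<le> R * \<bar>t - e\<bar>" for d R
    using that(1)
  proof
    assume "d \<in> one_sided_derivs a b \<phi>\<^sub>1"
    from one_sided_derivs_uminus[OF this] have "\<bar>- d\<bar> \<le> ereal R"
      using R(2) by (intro one_sided_derivs_le[OF cc1]) auto
    then show ?thesis by simp
  next
    assume "d \<in> one_sided_derivs a b \<phi>\<^sub>2"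
    show ?thesis by (rule one_sided_derivs_le[OF cc R(1) \<open>d \<in> one_sided_derivs a b \<phi>\<^sub>2\<close>])
  qed
  have "?m \<le> ereal S"
    unfolding max_slope_def using derivs_le top bottom by (intro SUP_least) blast
  then show fin: "?m < \<infinity>" by (auto simp: less_eq_ereal_def)
  define x where "x = (a + b) / 2"
  have x: "x \<in> {a<..<b}" "x \<in> {a..b}" using ab by (auto simp: x_def)
  have end_slopes: "\<phi>\<^sub>2 t - \<phi>\<^sub>2 e \<le> m * \<bar>t - e\<bar>" "\<phi>\<^sub>1 e - \<phi>\<^sub>1 t \<le> m * \<bar>t - e\<bar>"
    if "?m \<le> ereal m" "e \<in> {a, b}" "t \<in> {a..b}" for m e t
  proof -
    have m: "\<bar>d\<bar> \<le> ereal m" if "d \<in> one_sided_derivs a b \<phi>\<^sub>1 \<union> one_sided_derivs a b \<phi>\<^sub>2" for d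
      using \<open>?m \<le> ereal m\<close> that unfolding max_slope_def SUP_le_iff by blast
    show "\<phi>\<^sub>2 t - \<phi>\<^sub>2 e \<le> m * \<bar>t - e\<bar>"
    proof (rule end_slopes_le[OF cc ab top _ that(2,3)])
      show "\<bar>d\<bar> \<le> ereal m" if "d \<in> one_sided_derivs a b \<phi>\<^sub>2" for d
        using m that by blast
    qed
    have "- \<phi>\<^sub>1 t - - \<phi>\<^sub>1 e \<le> m * \<bar>t - e\<bar>"
    proof (rule end_slopes_le[OF cc1 ab _ _ that(2,3)])
      show "- \<phi>\<^sub>1 t - - \<phi>\<^sub>1 e \<le> S * \<bar>t - e\<bar>" if "e \<in> {a, b}" "t \<in> {a..b}" for e t
        using bottom[OF that] by simp
      show "\<bar>d\<bar> \<le> ereal m" if "d \<in> one_sided_derivs a b (\<lambda>x. - \<phi>\<^sub>1 x)" for d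
        using m[of "- d"] one_sided_derivs_uminus[OF that] by simp
    qed
    then show "\<phi>\<^sub>1 e - \<phi>\<^sub>1 t \<le> m * \<bar>t - e\<bar>" by simp
  qed
  \<comment> \<open>With \<open>m = 0\<close> both graphs would be constant, although they meet at \<open>a\<close> and are apart inside.\<close>
  have pos: "0 < ?m"
  proof (rule ccontr)
    assume "\<not> 0 < ?m"
    then have "?m \<le> ereal 0" by (simp add: zero_ereal_def[symmetric])
    from end_slopes[OF this, of a x] x corners strict[OF x(1)] show False by simp
  qed
  then obtain m where m: "?m = ereal m" "0 < m" using fin by (cases ?m) auto
  have "K_inf \<Omega> \<le> ?m"
    unfolding m using m end_slopes[of m] corners by (intro K_inf_le) auto
  moreover have "?m \<le> K_inf \<Omega>"
  proof (rule ccontr)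
    assume "\<not> ?m \<le> K_inf \<Omega>"
    then have "max 0 (K_inf \<Omega>) < ?m" using pos by simp
    then obtain d where d: "d \<in> one_sided_derivs a b \<phi>\<^sub>1 \<union> one_sided_derivs a b \<phi>\<^sub>2" "max 0 (K_inf \<Omega>) < \<bar>d\<bar>"
      unfolding max_slope_def less_SUP_iff by blast
    then obtain R where R: "max 0 (K_inf \<Omega>) < ereal R" "ereal R < \<bar>d\<bar>" using ereal_dense2 by blast
    have R0: "R > 0" and K: "K_inf \<Omega> < ereal R" using R(1) by auto
    show False
    proof (cases "\<forall>e\<in>{a, b}. \<forall>t\<in>{a..b}. \<phi>\<^sub>2 t - \<phi>\<^sub>2 e \<le> R * \<bar>t - e\<bar> \<and> \<phi>\<^sub>1 e - \<phi>\<^sub>1 t \<le> R * \<bar>t - e\<bar>")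
      case True
      then have "\<bar>d\<bar> \<le> ereal R" using derivs_le[OF d(1)] by blast
      then show False using R(2) by simp
    next
      case False
      then obtain e t where "e \<in> {a, b}" "t \<in> {a..b}"
        "\<phi>\<^sub>2 t - \<phi>\<^sub>2 e > R * \<bar>t - e\<bar> \<or> \<phi>\<^sub>1 e - \<phi>\<^sub>1 t > R * \<bar>t - e\<bar>"
        by (meson not_le)
      then have "ereal R \<le> K_inf \<Omega>"
        using K_inf_ge_if_steep_top[of e t R] K_inf_ge_if_steep_bottom[of e t R] R0 by blast
      then show False using K by simp
    qed
  qed
  ultimately show "K_inf \<Omega> = ?m" by (rule antisym)
qed

lemma K_inf_infinite:
  assumes e: "e \<in> {a, b}" and n: "\<not> angular_support_line \<Omega> {p. fst p = e}"
  shows "K_inf \<Omega> = \<infinity>"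
proof -
  have eab: "e \<in> {a..b}" using e ab by auto
  have K: "ereal R \<le> K_inf \<Omega>" if "R > 0" for R
  proof (cases "\<phi>\<^sub>1 e = \<phi>\<^sub>2 e")
    case False
    then show ?thesis using K_inf_ge_if_edge[OF e _ that] le[OF eab] by simp
  next
    case True
    then obtain t where "t \<in> {a..b}" "\<phi>\<^sub>2 t - \<phi>\<^sub>2 e > R * \<bar>t - e\<bar> \<or> \<phi>\<^sub>1 e - \<phi>\<^sub>1 t > R * \<bar>t - e\<bar>"
      using n \<open>R > 0\<close> unfolding angular_iff_corner[OF e] by (meson less_imp_le not_le)
    then show ?thesis
      using K_inf_ge_if_steep_top[OF e] K_inf_ge_if_steep_bottom[OF e] that by blast
  qed
  have "ereal B \<le> K_inf \<Omega>" for B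
    using K[of "max B 1"] by (auto intro: order_trans[rotated])
  then show ?thesis by (rule ereal_top)
qed

end

theorem theorem8:
  fixes a b :: real
    and \<phi>\<^sub>1 \<phi>\<^sub>2 :: "real \<Rightarrow> real"
    and \<Omega> :: "(real \<times> real) set"
  assumes "\<Omega> = {(x, y). x \<in> {a..b} \<and> \<phi>\<^sub>1 x \<le> y \<and> y \<le> \<phi>\<^sub>2 x}"
    and "convex_compact_domain \<Omega>"
    and "convex_on {a..b} \<phi>\<^sub>1"
    and "concave_on {a..b} \<phi>\<^sub>2"
    and "\<forall>x\<in>{a..b}. \<phi>\<^sub>1 x \<le> \<phi>\<^sub>2 x"
  shows "if \<forall>L. support_line \<Omega> L \<and> vertical_line L \<longrightarrow> angular_support_line \<Omega> L
         then K_inf \<Omega> = max_slope a b \<phi>\<^sub>1 \<phi>\<^sub>2 \<and> max_slope a b \<phi>\<^sub>1 \<phi>\<^sub>2 < \<infinity>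
         else K_inf \<Omega> = \<infinity>"
proof -
  interpret graph_domain a b \<phi>\<^sub>1 \<phi>\<^sub>2 \<Omega>
    using assms by unfold_locales auto
  show ?thesis
  proof (cases "\<forall>e\<in>{a, b}. angular_support_line \<Omega> {p. fst p = e}")
    case True
    then have "\<phi>\<^sub>1 a = \<phi>\<^sub>2 a" "\<phi>\<^sub>1 b = \<phi>\<^sub>2 b" using angular_iff_corner by auto
    obtain Sa where Sa: "\<And>t. t \<in> {a..b} \<Longrightarrow> \<phi>\<^sub>2 t - \<phi>\<^sub>2 a \<le> Sa * \<bar>t - a\<bar> \<and> \<phi>\<^sub>1 a - \<phi>\<^sub>1 t \<le> Sa * \<bar>t - a\<bar>"
      using True angular_iff_corner[OF insertI1] by blast
    obtain Sb where Sb: "\<And>t. t \<in> {a..b} \<Longrightarrow> \<phi>\<^sub>2 t - \<phi>\<^sub>2 b \<le> Sb * \<bar>t - b\<bar> \<and> \<phi>\<^sub>1 b - \<phi>\<^sub>1 t \<le> Sb * \<bar>t - b\<bar>"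
      using True angular_iff_corner[OF insertI2[OF singletonI]] by blast
    have S: "\<phi>\<^sub>2 t - \<phi>\<^sub>2 e \<le> max Sa Sb * \<bar>t - e\<bar>" "\<phi>\<^sub>1 e - \<phi>\<^sub>1 t \<le> max Sa Sb * \<bar>t - e\<bar>"
      if "e \<in> {a, b}" "t \<in> {a..b}" for e t
    proof -
      have "Sa * \<bar>t - e\<bar> \<le> max Sa Sb * \<bar>t - e\<bar>" "Sb * \<bar>t - e\<bar> \<le> max Sa Sb * \<bar>t - e\<bar>"
        by (simp_all add: mult_right_mono)
      then show "\<phi>\<^sub>2 t - \<phi>\<^sub>2 e \<le> max Sa Sb * \<bar>t - e\<bar>" "\<phi>\<^sub>1 e - \<phi>\<^sub>1 t \<le> max Sa Sb * \<bar>t - e\<bar>"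
        using Sa[OF that(2)] Sb[OF that(2)] that(1) by auto
    qed
    have "\<forall>L. support_line \<Omega> L \<and> vertical_line L \<longrightarrow> angular_support_line \<Omega> L"
      using True unfolding vertical_support_line_iff by blast
    then show ?thesis
      using K_inf_eq_max_slope[OF \<open>\<phi>\<^sub>1 a = \<phi>\<^sub>2 a\<close> \<open>\<phi>\<^sub>1 b = \<phi>\<^sub>2 b\<close> S] by simp
  next
    case False
    then have n: "\<not> (\<forall>L. support_line \<Omega> L \<and> vertical_line L \<longrightarrow> angular_support_line \<Omega> L)"
      unfolding vertical_support_line_iff by blast
    show ?thesis unfolding if_not_P[OF n] using False K_inf_infinite by blast
  qed
qed

end
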